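(* Let $X$ be a locale and let $\mathsf{u},\mathsf{d}\colon\mathcal{O}X\to\mathcal{O}X$ be a join-preserving parallel pair of functions. Then the localic relation $R_{\mathsf{u},\mathsf{d}}$ on $X$ has open cones, and its induced cones are $\Uparrow_{R_{\mathsf{u},\mathsf{d}}}=\mathsf{u}$ and $\Downarrow_{R_{\mathsf{u},\mathsf{d}}}=\mathsf{d}$.
   Context: Frames and locales. A frame is a complete lattice (order $\sqsubseteq$) in which $x\wedge\bigvee y_i=\bigvee (x\wedge y_i)$; frame maps preserve finite meets and all joins. The category of locales is the opposite of the category of frames: a locale $X$ has a frame of opens $\mathcal{O}X$, and a map $f\colon X\to Y$ is a frame map $f^{-1}\colon\mathcal{O}Y\to\mathcal{O}X$. $L\otimes M$ is the coproduct of frames, generated under joins by the rectangles $x\otimes y=\iota_1(x)\wedge\iota_2(y)$ ($\iota_1,\iota_2$ the coproduct injections); $\mathcal{O}(X\times Y)=\mathcal{O}X\otimes\mathcal{O}Y$. A sublocale of $X$ is (an isomorphism class of) an extremal monomorphism $A\rightarrowtail X$, equivalently a map whose frame map is surjective. Open cone relations. A localic relation on $X$ is a sublocale $r\colon R\rightarrowtail X\times X$; its source and target maps are $s=\mathrm{pr}_1\circ r$, $t=\mathrm{pr}_2\circ r\colon R\to X$. A locale map $f\colon X\to Y$ is open if $f^{-1}$ has a left adjoint $f_!$ with $f_!(U\wedge f^{-1}(V))=f_!(U)\wedge V$. $R$ has open cones if $s,t$ are open; then its induced cones are $\Uparrow_R:=t_!s^{-1}$ and $\Downarrow_R:=s_!t^{-1}\colon\mathcal{O}X\to\mathcal{O}X$.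 Parallel pairs and induced relation. Functions $\mathsf{u},\mathsf{d}\colon L\to L$ on a frame are parallel if $\mathsf{u}(x)\wedge y\sqsubseteq\mathsf{u}(x\wedge\mathsf{d}(y))$ and $x\wedge\mathsf{d}(y)\sqsubseteq\mathsf{d}(\mathsf{u}(x)\wedge y)$ for all $x,y\in L$. Given such a join-preserving pair on $\mathcal{O}X$, let $\sim$ be the binary relation on rectangles of $\mathcal{O}X\otimes\mathcal{O}X$ with $a\otimes b\sim c\otimes d$ iff $\mathsf{u}(a)\wedge b=\mathsf{u}(c)\wedge d$ and $a\wedge\mathsf{d}(b)=c\wedge\mathsf{d}(d)$. An element $o\in\mathcal{O}X\otimes\mathcal{O}X$ is $\sim$-saturated if for all $p\sim q$ and all $w$: $p\wedge w\sqsubseteq o$ iff $q\wedge w\sqsubseteq o$. $R_{\mathsf{u},\mathsf{d}}\rightarrowtail X\times X$ is the sublocale whose frame is the set of $\sim$-saturated elements, with frame map $\mu_\sim(o)=$ the least $\sim$-saturated element above $o$; equivalently, the quotient of $\mathcal{O}X\otimes\mathcal{O}X$ by the frame congruence generated by $\sim$. *)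

theory Defs
  imports "HOL-Algebra.Galois_Connection"
begin

section \<open>Frames and locales\<close>

text \<open>
  A locale is represented by its frame of opens; a map of locales from \<open>X\<close> to \<open>Y\<close> by a frame map
  from the opens of \<open>Y\<close> to the opens of \<open>X\<close>. The carriers are explicit since the frame of
  a sublocale depends on the data defining it.
\<close>

locale frame = complete_lattice L for L (structure) +
  assumes meet_sup_distrib:
    "\<lbrakk>x \<in> carrier L; Y \<subseteq> carrier L\<rbrakk> \<Longrightarrow> x \<sqinter> \<Squnion>Y = \<Squnion>((\<lambda>y. x \<sqinter> y) ` Y)"

definition frame_map :: "'a gorder \<Rightarrow> 'b gorder \<Rightarrow> ('a \<Rightarrow> 'b) \<Rightarrow> bool" where
  "frame_map L M f \<longleftrightarrow>
     frame L \<and> frame M \<and> f \<in> carrier L \<rightarrow> carrier M \<and>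
     f \<top>\<^bsub>L\<^esub> = \<top>\<^bsub>M\<^esub> \<and> meet_pres L M f \<and> sup_pres L M f"

text \<open>Openness of the locale map whose frame map is \<open>f\<close>: \<open>L \<rightarrow> M\<close>.\<close>

definition left_adjoint :: "'a gorder \<Rightarrow> 'b gorder \<Rightarrow> ('a \<Rightarrow> 'b) \<Rightarrow> ('b \<Rightarrow> 'a) \<Rightarrow> bool" where
  "left_adjoint L M f g \<longleftrightarrow>
     galois_connection \<lparr>orderA = M, orderB = L, lower = g, upper = f\<rparr>"

definition open_map :: "'a gorder \<Rightarrow> 'b gorder \<Rightarrow> ('a \<Rightarrow> 'b) \<Rightarrow> bool" where
  "open_map L M f \<longleftrightarrow>
     frame_map L M f \<and>
     (\<exists>g. left_adjoint L M f g \<and>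
       (\<forall>U\<in>carrier M. \<forall>V\<in>carrier L. g (U \<sqinter>\<^bsub>M\<^esub> f V) = g U \<sqinter>\<^bsub>L\<^esub> V))"

text \<open>The map \<open>f\<^sub>!\<close>; on the carrier of \<open>M\<close> a left adjoint is unique (\<open>left_adjoint_unique\<close>).\<close>

definition direct_image :: "'a gorder \<Rightarrow> 'b gorder \<Rightarrow> ('a \<Rightarrow> 'b) \<Rightarrow> 'b \<Rightarrow> 'a" where
  "direct_image L M f = (SOME g. left_adjoint L M f g)"

lemma left_adjoint_unique:
  assumes "left_adjoint L M f g" "left_adjoint L M f h" "y \<in> carrier M"
  shows "g y = h y"
proof -
  let ?G = "\<lparr>orderA = M, orderB = L, lower = g, upper = f\<rparr>"
  let ?H = "\<lparr>orderA = M, orderB = L, lower = h, upper = f\<rparr>"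
  interpret G: galois_connection ?G using assms(1) by (simp add: left_adjoint_def)
  interpret H: galois_connection ?H using assms(2) by (simp add: left_adjoint_def)
  interpret L: partial_order L using G.is_order_B by simp
  have c: "g y \<in> carrier L" "h y \<in> carrier L"
    using G.lower_closed[of y] H.lower_closed[of y] assms(3) by auto
  show ?thesis
    using G.galois_property[of y "h y"] H.galois_property[of y "g y"]
      G.inflation[of y] H.inflation[of y] c assms(3) by (auto intro: L.le_antisym)
qed


section \<open>The coproduct of frames\<close>

text \<open>
  The coproduct is constructed as the frame of those down-sets of \<open>L \<times> M\<close> that are closed under
  joins in each coordinate (taking empty joins, they contain all pairs with a bottom component).
  That this is a frame coproduct generated by rectangles is shown in \<open>frame_tensor\<close>,
  \<open>frame_map_inj1\<close>, \<open>frame_map_inj2\<close>, \<open>tensor_generated\<close> and \<open>tensor_universal\<close>.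
\<close>

definition tensor_ideal :: "'a gorder \<Rightarrow> 'b gorder \<Rightarrow> ('a \<times> 'b) set \<Rightarrow> bool" where
  "tensor_ideal L M I \<longleftrightarrow>
     I \<subseteq> carrier L \<times> carrier M \<and>
     (\<forall>a b. (a, b) \<in> I \<longrightarrow>
       (\<forall>x\<in>carrier L. \<forall>y\<in>carrier M. x \<sqsubseteq>\<^bsub>L\<^esub> a \<longrightarrow> y \<sqsubseteq>\<^bsub>M\<^esub> b \<longrightarrow> (x, y) \<in> I)) \<and>
     (\<forall>A\<subseteq>carrier L. \<forall>b\<in>carrier M. A \<times> {b} \<subseteq> I \<longrightarrow> (\<Squnion>\<^bsub>L\<^esub>A, b) \<in> I) \<and>
     (\<forall>a\<in>carrier L. \<forall>B\<subseteq>carrier M. {a} \<times> B \<subseteq> I \<longrightarrow> (a, \<Squnion>\<^bsub>M\<^esub>B) \<in> I)"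

definition tensor :: "'a gorder \<Rightarrow> 'b gorder \<Rightarrow> ('a \<times> 'b) set gorder" where
  "tensor L M = \<lparr>carrier = {I. tensor_ideal L M I}, eq = (=), le = (\<subseteq>)\<rparr>"

definition inj1 :: "'a gorder \<Rightarrow> 'b gorder \<Rightarrow> 'a \<Rightarrow> ('a \<times> 'b) set" where
  "inj1 L M x = \<Inter>{I. tensor_ideal L M I \<and> (x, \<top>\<^bsub>M\<^esub>) \<in> I}"

definition inj2 :: "'a gorder \<Rightarrow> 'b gorder \<Rightarrow> 'b \<Rightarrow> ('a \<times> 'b) set" where
  "inj2 L M y = \<Inter>{I. tensor_ideal L M I \<and> (\<top>\<^bsub>L\<^esub>, y) \<in> I}"

definition rect :: "'a gorder \<Rightarrow> 'b gorder \<Rightarrow> 'a \<Rightarrow> 'b \<Rightarrow> ('a \<times> 'b) set" where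
  "rect L M x y = inj1 L M x \<sqinter>\<^bsub>tensor L M\<^esub> inj2 L M y"

lemma tensor_idealI:
  assumes "I \<subseteq> carrier L \<times> carrier M"
    and "\<And>a b x y. \<lbrakk>(a, b) \<in> I; x \<in> carrier L; y \<in> carrier M; x \<sqsubseteq>\<^bsub>L\<^esub> a; y \<sqsubseteq>\<^bsub>M\<^esub> b\<rbrakk> \<Longrightarrow> (x, y) \<in> I"
    and "\<And>A b. \<lbrakk>A \<subseteq> carrier L; b \<in> carrier M; \<And>a. a \<in> A \<Longrightarrow> (a, b) \<in> I\<rbrakk> \<Longrightarrow> (\<Squnion>\<^bsub>L\<^esub>A, b) \<in> I"
    and "\<And>a B. \<lbrakk>a \<in> carrier L; B \<subseteq> carrier M; \<And>b. b \<in> B \<Longrightarrow> (a, b) \<in> I\<rbrakk> \<Longrightarrow> (a, \<Squnion>\<^bsub>M\<^esub>B) \<in> I"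
  shows "tensor_ideal L M I"
proof -
  have "(\<Squnion>\<^bsub>L\<^esub>A, b) \<in> I" if "A \<subseteq> carrier L" "b \<in> carrier M" "A \<times> {b} \<subseteq> I" for A b
    using that by (intro assms(3)) auto
  moreover have "(a, \<Squnion>\<^bsub>M\<^esub>B) \<in> I" if "a \<in> carrier L" "B \<subseteq> carrier M" "{a} \<times> B \<subseteq> I" for a B
    using that by (intro assms(4)) auto
  ultimately have closed:
    "\<forall>A\<subseteq>carrier L. \<forall>b\<in>carrier M. A \<times> {b} \<subseteq> I \<longrightarrow> (\<Squnion>\<^bsub>L\<^esub>A, b) \<in> I"
    "\<forall>a\<in>carrier L. \<forall>B\<subseteq>carrier M. {a} \<times> B \<subseteq> I \<longrightarrow> (a, \<Squnion>\<^bsub>M\<^esub>B) \<in> I"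
    by simp_all
  have down: "\<forall>a b. (a, b) \<in> I \<longrightarrow>
    (\<forall>x\<in>carrier L. \<forall>y\<in>carrier M. x \<sqsubseteq>\<^bsub>L\<^esub> a \<longrightarrow> y \<sqsubseteq>\<^bsub>M\<^esub> b \<longrightarrow> (x, y) \<in> I)"
    by (intro allI ballI impI) (rule assms(2))
  show ?thesis
    unfolding tensor_ideal_def
    by (rule conjI[OF assms(1) conjI[OF down conjI[OF closed]]])
qed

lemma tensor_idealD:
  assumes "tensor_ideal L M I"
  shows "(a, b) \<in> I \<Longrightarrow> a \<in> carrier L"
    and "(a, b) \<in> I \<Longrightarrow> b \<in> carrier M"
    and "\<lbrakk>(a, b) \<in> I; x \<in> carrier L; y \<in> carrier M; x \<sqsubseteq>\<^bsub>L\<^esub> a; y \<sqsubseteq>\<^bsub>M\<^esub> b\<rbrakk> \<Longrightarrow> (x, y) \<in> I"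
    and "\<lbrakk>A \<subseteq> carrier L; b \<in> carrier M; \<And>a. a \<in> A \<Longrightarrow> (a, b) \<in> I\<rbrakk> \<Longrightarrow> (\<Squnion>\<^bsub>L\<^esub>A, b) \<in> I"
    and "\<lbrakk>a \<in> carrier L; B \<subseteq> carrier M; \<And>b. b \<in> B \<Longrightarrow> (a, b) \<in> I\<rbrakk> \<Longrightarrow> (a, \<Squnion>\<^bsub>M\<^esub>B) \<in> I"
proof -
  note D = assms[unfolded tensor_ideal_def]
  note D1 = D[THEN conjunct1] and D2 = D[THEN conjunct2, THEN conjunct1, rule_format]
    and D3 = D[THEN conjunct2, THEN conjunct2, THEN conjunct1, rule_format]
    and D4 = D[THEN conjunct2, THEN conjunct2, THEN conjunct2, rule_format]
  show "(a, b) \<in> I \<Longrightarrow> a \<in> carrier L" "(a, b) \<in> I \<Longrightarrow> b \<in> carrier M"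
    using D1 by auto
  show "\<lbrakk>(a, b) \<in> I; x \<in> carrier L; y \<in> carrier M; x \<sqsubseteq>\<^bsub>L\<^esub> a; y \<sqsubseteq>\<^bsub>M\<^esub> b\<rbrakk> \<Longrightarrow> (x, y) \<in> I"
    by (rule D2)
  show "(\<Squnion>\<^bsub>L\<^esub>A, b) \<in> I" if "A \<subseteq> carrier L" "b \<in> carrier M" "\<And>a. a \<in> A \<Longrightarrow> (a, b) \<in> I"
    by (rule D3) (use that in auto)
  show "(a, \<Squnion>\<^bsub>M\<^esub>B) \<in> I" if "a \<in> carrier L" "B \<subseteq> carrier M" "\<And>b. b \<in> B \<Longrightarrow> (a, b) \<in> I"
    by (rule D4) (use that in auto)
qed

lemma tensor_simps [simp]:
  "carrier (tensor L M) = {I. tensor_ideal L M I}"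
  "eq (tensor L M) = (=)"
  "(I \<sqsubseteq>\<^bsub>tensor L M\<^esub> J) = (I \<subseteq> J)"
  by (simp_all add: tensor_def)

locale frame_pair = L: frame L + M: frame M
  for L :: "'a gorder" and M :: "'b gorder"
begin

lemma ideal_top: "tensor_ideal L M (carrier L \<times> carrier M)"
  by (rule tensor_idealI) auto

lemma ideal_Inter:
  assumes "\<And>I. I \<in> S \<Longrightarrow> tensor_ideal L M I" "S \<noteq> {}"
  shows "tensor_ideal L M (\<Inter>S)"
proof (rule tensor_idealI)
  show "\<Inter>S \<subseteq> carrier L \<times> carrier M"
  proof -
    obtain I where "I \<in> S" using assms(2) by auto
    then show ?thesis using tensor_idealD(1,2)[OF assms(1)] by auto
  qed
  fix a b x y
  assume "(a, b) \<in> \<Inter>S" "x \<in> carrier L" "y \<in> carrier M" "x \<sqsubseteq>\<^bsub>L\<^esub> a" "y \<sqsubseteq>\<^bsub>M\<^esub> b"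
  then show "(x, y) \<in> \<Inter>S"
    by (intro InterI, rule_tac a = a and b = b in tensor_idealD(3)[OF assms(1)]) simp_all
next
  fix A b assume "A \<subseteq> carrier L" "b \<in> carrier M" "\<And>a. a \<in> A \<Longrightarrow> (a, b) \<in> \<Inter>S"
  then show "(\<Squnion>\<^bsub>L\<^esub>A, b) \<in> \<Inter>S"
    by (intro InterI tensor_idealD(4)[OF assms(1)]) simp_all
next
  fix a B assume "a \<in> carrier L" "B \<subseteq> carrier M" "\<And>b. b \<in> B \<Longrightarrow> (a, b) \<in> \<Inter>S"
  then show "(a, \<Squnion>\<^bsub>M\<^esub>B) \<in> \<Inter>S"
    by (intro InterI tensor_idealD(5)[OF assms(1)]) simp_all
qed

lemma ideal_Int: "tensor_ideal L M I \<Longrightarrow> tensor_ideal L M J \<Longrightarrow> tensor_ideal L M (I \<inter> J)"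
  using ideal_Inter[of "{I, J}"] by auto

lemma partial_order_tensor: "partial_order (tensor L M)"
  by standard auto

lemma complete_lattice_tensor: "complete_lattice (tensor L M)"
proof -
  interpret T: partial_order "tensor L M" by (rule partial_order_tensor)
  show ?thesis
  proof (rule T.complete_lattice_criterion1)
    show "\<exists>g. greatest (tensor L M) g (carrier (tensor L M))"
      by (rule exI[of _ "carrier L \<times> carrier M"])
        (auto simp: greatest_def ideal_top dest: tensor_idealD(1,2))
    fix S assume "S \<subseteq> carrier (tensor L M)" "S \<noteq> {}"
    then show "\<exists>i. greatest (tensor L M) i (Lower (tensor L M) S)"
      by (intro exI[of _ "\<Inter>S"]) (auto simp: greatest_def Lower_def ideal_Inter subset_eq)
  qed
qed

sublocale T: complete_lattice "tensor L M"
  by (rule complete_lattice_tensor)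

lemma tensor_top: "\<top>\<^bsub>tensor L M\<^esub> = carrier L \<times> carrier M"
  by (rule T.le_antisym) (use T.top_closed T.top_higher ideal_top in \<open>auto dest: tensor_idealD(1,2)\<close>)

lemma tensor_meet:
  assumes "tensor_ideal L M I" "tensor_ideal L M J"
  shows "I \<sqinter>\<^bsub>tensor L M\<^esub> J = I \<inter> J"
  using assms ideal_Int[OF assms] T.meet_left[of I J] T.meet_right[of I J] T.meet_le[of "I \<inter> J" I J]
  by auto

lemma tensor_sup_closed:
  "S \<subseteq> {I. tensor_ideal L M I} \<Longrightarrow> tensor_ideal L M (\<Squnion>\<^bsub>tensor L M\<^esub>S)"
  using T.sup_closed[of S] by simp

lemma tensor_sup_upper:
  "S \<subseteq> {I. tensor_ideal L M I} \<Longrightarrow> I \<in> S \<Longrightarrow> I \<subseteq> \<Squnion>\<^bsub>tensor L M\<^esub>S"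
  using T.sup_upper[of S I] by simp

lemma tensor_sup_least:
  "S \<subseteq> {I. tensor_ideal L M I} \<Longrightarrow> tensor_ideal L M J \<Longrightarrow> (\<And>I. I \<in> S \<Longrightarrow> I \<subseteq> J)
    \<Longrightarrow> \<Squnion>\<^bsub>tensor L M\<^esub>S \<subseteq> J"
  using T.sup_least[of S J] by simp

lemma ideal_residual:
  assumes I: "I \<subseteq> carrier L \<times> carrier M" and J: "tensor_ideal L M J"
  shows "tensor_ideal L M
    {(x, y). x \<in> carrier L \<and> y \<in> carrier M \<and> (\<forall>(a, b)\<in>I. (a \<sqinter>\<^bsub>L\<^esub> x, b \<sqinter>\<^bsub>M\<^esub> y) \<in> J)}"
    (is "tensor_ideal L M ?K")
proof (rule tensor_idealI)
  fix a b x y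
  assume *: "(a, b) \<in> ?K" "x \<in> carrier L" "y \<in> carrier M" "x \<sqsubseteq>\<^bsub>L\<^esub> a" "y \<sqsubseteq>\<^bsub>M\<^esub> b"
  have "(c \<sqinter>\<^bsub>L\<^esub> x, d \<sqinter>\<^bsub>M\<^esub> y) \<in> J" if "(c, d) \<in> I" for c d
  proof (rule tensor_idealD(3)[OF J])
    show "(c \<sqinter>\<^bsub>L\<^esub> a, d \<sqinter>\<^bsub>M\<^esub> b) \<in> J" using * that by auto
    have cd: "c \<in> carrier L" "d \<in> carrier M" using that I by auto
    show "c \<sqinter>\<^bsub>L\<^esub> x \<in> carrier L" "d \<sqinter>\<^bsub>M\<^esub> y \<in> carrier M" using cd * by auto
    show "c \<sqinter>\<^bsub>L\<^esub> x \<sqsubseteq>\<^bsub>L\<^esub> c \<sqinter>\<^bsub>L\<^esub> a"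
      using cd * by (auto intro!: L.meet_le L.meet_left intro: L.le_trans[OF L.meet_right])
    show "d \<sqinter>\<^bsub>M\<^esub> y \<sqsubseteq>\<^bsub>M\<^esub> d \<sqinter>\<^bsub>M\<^esub> b"
      using cd * by (auto intro!: M.meet_le M.meet_left intro: M.le_trans[OF M.meet_right])
  qed
  with * show "(x, y) \<in> ?K" by auto
next
  fix A b assume *: "A \<subseteq> carrier L" "b \<in> carrier M" "\<And>a. a \<in> A \<Longrightarrow> (a, b) \<in> ?K"
  have "(c \<sqinter>\<^bsub>L\<^esub> \<Squnion>\<^bsub>L\<^esub>A, d \<sqinter>\<^bsub>M\<^esub> b) \<in> J" if "(c, d) \<in> I" for c d
  proof -
    have cd: "c \<in> carrier L" "d \<in> carrier M" using that I by auto
    have "(\<Squnion>\<^bsub>L\<^esub>((\<lambda>a. c \<sqinter>\<^bsub>L\<^esub> a) ` A), d \<sqinter>\<^bsub>M\<^esub> b) \<in> J"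
      by (rule tensor_idealD(4)[OF J]) (use cd *(1,2) that in \<open>auto dest!: *(3)\<close>)
    then show ?thesis using L.meet_sup_distrib cd * by simp
  qed
  with * show "(\<Squnion>\<^bsub>L\<^esub>A, b) \<in> ?K" by auto
next
  fix a B assume *: "a \<in> carrier L" "B \<subseteq> carrier M" "\<And>b. b \<in> B \<Longrightarrow> (a, b) \<in> ?K"
  have "(c \<sqinter>\<^bsub>L\<^esub> a, d \<sqinter>\<^bsub>M\<^esub> \<Squnion>\<^bsub>M\<^esub>B) \<in> J" if "(c, d) \<in> I" for c d
  proof -
    have cd: "c \<in> carrier L" "d \<in> carrier M" using that I by auto
    have "(c \<sqinter>\<^bsub>L\<^esub> a, \<Squnion>\<^bsub>M\<^esub>((\<lambda>b. d \<sqinter>\<^bsub>M\<^esub> b) ` B)) \<in> J"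
      by (rule tensor_idealD(5)[OF J]) (use cd *(1,2) that in \<open>auto dest!: *(3)\<close>)
    then show ?thesis using M.meet_sup_distrib cd * by simp
  qed
  with * show "(a, \<Squnion>\<^bsub>M\<^esub>B) \<in> ?K" by auto
qed auto

lemma frame_tensor: "frame (tensor L M)"
proof (intro frame.intro complete_lattice_tensor frame_axioms.intro)
  fix I S assume I: "I \<in> carrier (tensor L M)" and S: "S \<subseteq> carrier (tensor L M)"
  let ?T = "tensor L M"
  let ?S' = "(\<lambda>J. I \<sqinter>\<^bsub>?T\<^esub> J) ` S"
  let ?K = "{(x, y). x \<in> carrier L \<and> y \<in> carrier M \<and>
    (\<forall>(a, b)\<in>I. (a \<sqinter>\<^bsub>L\<^esub> x, b \<sqinter>\<^bsub>M\<^esub> y) \<in> \<Squnion>\<^bsub>?T\<^esub>?S')}"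
  have I': "tensor_ideal L M I" using I by simp
  have S': "?S' \<subseteq> {I. tensor_ideal L M I}" using I S T.meet_closed by auto
  have K: "tensor_ideal L M ?K"
    by (rule ideal_residual) (use I' tensor_sup_closed[OF S'] in \<open>auto dest: tensor_idealD(1,2)\<close>)
  have SK: "\<Squnion>\<^bsub>?T\<^esub>S \<subseteq> ?K"
  proof (rule tensor_sup_least)
    fix J assume J: "J \<in> S"
    then have J': "tensor_ideal L M J" using S by auto
    show "J \<subseteq> ?K"
    proof clarify
      fix x y assume xy: "(x, y) \<in> J"
      then have c: "x \<in> carrier L" "y \<in> carrier M" using J' by (auto dest: tensor_idealD(1,2))
      have "(a \<sqinter>\<^bsub>L\<^esub> x, b \<sqinter>\<^bsub>M\<^esub> y) \<in> \<Squnion>\<^bsub>?T\<^esub>?S'" if ab: "(a, b) \<in> I" for a b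
      proof -
        have c': "a \<in> carrier L" "b \<in> carrier M" using I' ab by (auto dest: tensor_idealD(1,2))
        have "(a \<sqinter>\<^bsub>L\<^esub> x, b \<sqinter>\<^bsub>M\<^esub> y) \<in> I"
          by (rule tensor_idealD(3)[OF I' ab]) (use c c' L.meet_left M.meet_left in auto)
        moreover have "(a \<sqinter>\<^bsub>L\<^esub> x, b \<sqinter>\<^bsub>M\<^esub> y) \<in> J"
          by (rule tensor_idealD(3)[OF J' xy]) (use c c' L.meet_right M.meet_right in auto)
        ultimately have "(a \<sqinter>\<^bsub>L\<^esub> x, b \<sqinter>\<^bsub>M\<^esub> y) \<in> I \<sqinter>\<^bsub>?T\<^esub> J" using tensor_meet I' J' by auto
        then show ?thesis using tensor_sup_upper[OF S'] J by blast
      qed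
      with c show "x \<in> carrier L \<and> y \<in> carrier M \<and>
        (\<forall>(a, b)\<in>I. (a \<sqinter>\<^bsub>L\<^esub> x, b \<sqinter>\<^bsub>M\<^esub> y) \<in> \<Squnion>\<^bsub>?T\<^esub>?S')" by auto
    qed
  qed (use S K in auto)
  have supS: "tensor_ideal L M (\<Squnion>\<^bsub>?T\<^esub>S)" using tensor_sup_closed S by simp
  show "I \<sqinter>\<^bsub>?T\<^esub> \<Squnion>\<^bsub>?T\<^esub>S = \<Squnion>\<^bsub>?T\<^esub>?S'"
  proof
    show "I \<sqinter>\<^bsub>?T\<^esub> \<Squnion>\<^bsub>?T\<^esub>S \<subseteq> \<Squnion>\<^bsub>?T\<^esub>?S'"
    proof clarify
      fix x y assume "(x, y) \<in> I \<sqinter>\<^bsub>?T\<^esub> \<Squnion>\<^bsub>?T\<^esub>S"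
      then have xy: "(x, y) \<in> I" "(x, y) \<in> \<Squnion>\<^bsub>?T\<^esub>S" using tensor_meet[OF I' supS] by auto
      then have c: "x \<in> carrier L" "y \<in> carrier M" using I' by (auto dest: tensor_idealD(1,2))
      have xx: "x \<sqinter>\<^bsub>L\<^esub> x = x" "y \<sqinter>\<^bsub>M\<^esub> y = y"
        using c L.le_iff_join[of x x] M.le_iff_join[of y y] by auto
      have "(x \<sqinter>\<^bsub>L\<^esub> x, y \<sqinter>\<^bsub>M\<^esub> y) \<in> \<Squnion>\<^bsub>?T\<^esub>?S'" using xy SK by auto
      then show "(x, y) \<in> \<Squnion>\<^bsub>?T\<^esub>?S'" by (simp add: xx)
    qed
    show "\<Squnion>\<^bsub>?T\<^esub>?S' \<subseteq> I \<sqinter>\<^bsub>?T\<^esub> \<Squnion>\<^bsub>?T\<^esub>S"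
    proof (rule tensor_sup_least[OF S'])
      show "tensor_ideal L M (I \<sqinter>\<^bsub>?T\<^esub> \<Squnion>\<^bsub>?T\<^esub>S)"
        using tensor_meet[OF I' supS] ideal_Int[OF I' supS] by simp
      fix K assume "K \<in> ?S'"
      then obtain J where J: "J \<in> S" "K = I \<sqinter>\<^bsub>?T\<^esub> J" by blast
      then have J': "tensor_ideal L M J" using S by auto
      have "J \<subseteq> \<Squnion>\<^bsub>?T\<^esub>S" using tensor_sup_upper[of S J] S J by simp
      then show "K \<subseteq> I \<sqinter>\<^bsub>?T\<^esub> \<Squnion>\<^bsub>?T\<^esub>S" using J tensor_meet[OF I' supS] tensor_meet[OF I' J'] by auto
    qed
  qed
qed

lemma ideal_bottom_rows:
  assumes "tensor_ideal L M I" "x \<in> carrier L" "y \<in> carrier M"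
  shows "(\<bottom>\<^bsub>L\<^esub>, y) \<in> I" "(x, \<bottom>\<^bsub>M\<^esub>) \<in> I"
proof -
  have "\<Squnion>\<^bsub>L\<^esub>{} = \<bottom>\<^bsub>L\<^esub>" "\<Squnion>\<^bsub>M\<^esub>{} = \<bottom>\<^bsub>M\<^esub>"
    using L.weak.weak_sup_empty M.weak.weak_sup_empty L.eq_is_equal M.eq_is_equal by auto
  then show "(\<bottom>\<^bsub>L\<^esub>, y) \<in> I" "(x, \<bottom>\<^bsub>M\<^esub>) \<in> I"
    using tensor_idealD(4)[OF assms(1), of "{}" y] tensor_idealD(5)[OF assms(1), of x "{}"] assms
    by auto
qed

definition gen :: "'a \<Rightarrow> 'b \<Rightarrow> ('a \<times> 'b) set" where
  "gen a b = {(x, y). x \<in> carrier L \<and> y \<in> carrier M \<and>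
     (x = \<bottom>\<^bsub>L\<^esub> \<or> y = \<bottom>\<^bsub>M\<^esub> \<or> x \<sqsubseteq>\<^bsub>L\<^esub> a \<and> y \<sqsubseteq>\<^bsub>M\<^esub> b)}"

lemma ideal_gen:
  assumes ab: "a \<in> carrier L" "b \<in> carrier M"
  shows "tensor_ideal L M (gen a b)"
proof (rule tensor_idealI)
  fix c d x y
  assume *: "(c, d) \<in> gen a b" "x \<in> carrier L" "y \<in> carrier M" "x \<sqsubseteq>\<^bsub>L\<^esub> c" "y \<sqsubseteq>\<^bsub>M\<^esub> d"
  then have c: "c \<in> carrier L" "d \<in> carrier M" by (auto simp: gen_def)
  consider "c = \<bottom>\<^bsub>L\<^esub>" | "d = \<bottom>\<^bsub>M\<^esub>" | "c \<sqsubseteq>\<^bsub>L\<^esub> a" "d \<sqsubseteq>\<^bsub>M\<^esub> b" using * by (auto simp: gen_def)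
  then show "(x, y) \<in> gen a b"
  proof cases
    case 1
    then have "x = \<bottom>\<^bsub>L\<^esub>" using * L.le_antisym[of x "\<bottom>\<^bsub>L\<^esub>"] L.bottom_lower by auto
    then show ?thesis using * by (auto simp: gen_def)
  next
    case 2
    then have "y = \<bottom>\<^bsub>M\<^esub>" using * M.le_antisym[of y "\<bottom>\<^bsub>M\<^esub>"] M.bottom_lower by auto
    then show ?thesis using * by (auto simp: gen_def)
  next
    case 3
    then have "x \<sqsubseteq>\<^bsub>L\<^esub> a" "y \<sqsubseteq>\<^bsub>M\<^esub> b"
      using * c ab L.le_trans[of x c a] M.le_trans[of y d b] by auto
    then show ?thesis using * by (auto simp: gen_def)
  qed
next
  fix A y assume *: "A \<subseteq> carrier L" "y \<in> carrier M" "\<And>x. x \<in> A \<Longrightarrow> (x, y) \<in> gen a b"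
  show "(\<Squnion>\<^bsub>L\<^esub>A, y) \<in> gen a b"
  proof (cases "y = \<bottom>\<^bsub>M\<^esub> \<or> y \<sqsubseteq>\<^bsub>M\<^esub> b")
    case True
    have "\<Squnion>\<^bsub>L\<^esub>A \<sqsubseteq>\<^bsub>L\<^esub> a" if "y \<noteq> \<bottom>\<^bsub>M\<^esub>"
      using *(1,2) ab that by (intro L.sup_least) (auto simp: gen_def L.bottom_lower dest!: *(3))
    then show ?thesis using True * by (auto simp: gen_def)
  next
    case False
    then have "A \<subseteq> {\<bottom>\<^bsub>L\<^esub>}" using * by (auto simp: gen_def)
    then have "\<Squnion>\<^bsub>L\<^esub>A \<sqsubseteq>\<^bsub>L\<^esub> \<bottom>\<^bsub>L\<^esub>" using * by (intro L.sup_least) auto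
    then have "\<Squnion>\<^bsub>L\<^esub>A = \<bottom>\<^bsub>L\<^esub>" using * L.le_antisym[of "\<Squnion>\<^bsub>L\<^esub>A" "\<bottom>\<^bsub>L\<^esub>"] L.bottom_lower by auto
    then show ?thesis using * by (auto simp: gen_def)
  qed
next
  fix x B assume *: "x \<in> carrier L" "B \<subseteq> carrier M" "\<And>y. y \<in> B \<Longrightarrow> (x, y) \<in> gen a b"
  show "(x, \<Squnion>\<^bsub>M\<^esub>B) \<in> gen a b"
  proof (cases "x = \<bottom>\<^bsub>L\<^esub> \<or> x \<sqsubseteq>\<^bsub>L\<^esub> a")
    case True
    have "\<Squnion>\<^bsub>M\<^esub>B \<sqsubseteq>\<^bsub>M\<^esub> b" if "x \<noteq> \<bottom>\<^bsub>L\<^esub>"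
      using *(1,2) ab that by (intro M.sup_least) (auto simp: gen_def M.bottom_lower dest!: *(3))
    then show ?thesis using True * by (auto simp: gen_def)
  next
    case False
    then have "B \<subseteq> {\<bottom>\<^bsub>M\<^esub>}" using * by (auto simp: gen_def)
    then have "\<Squnion>\<^bsub>M\<^esub>B \<sqsubseteq>\<^bsub>M\<^esub> \<bottom>\<^bsub>M\<^esub>" using * by (intro M.sup_least) auto
    then have "\<Squnion>\<^bsub>M\<^esub>B = \<bottom>\<^bsub>M\<^esub>" using * M.le_antisym[of "\<Squnion>\<^bsub>M\<^esub>B" "\<bottom>\<^bsub>M\<^esub>"] M.bottom_lower by auto
    then show ?thesis using * by (auto simp: gen_def)
  qed
qed (auto simp: gen_def)

lemma gen_least:
  assumes "tensor_ideal L M I" "(a, b) \<in> I"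
  shows "gen a b \<subseteq> I"
proof clarify
  fix x y assume "(x, y) \<in> gen a b"
  then show "(x, y) \<in> I"
    using assms ideal_bottom_rows[OF assms(1)] tensor_idealD(3)[OF assms(1,2)]
    by (auto simp: gen_def)
qed

lemma gen_mem: "a \<in> carrier L \<Longrightarrow> b \<in> carrier M \<Longrightarrow> (a, b) \<in> gen a b"
  by (simp add: gen_def)

lemma inj1_eq:
  assumes "a \<in> carrier L" shows "inj1 L M a = gen a \<top>\<^bsub>M\<^esub>"
proof
  show "inj1 L M a \<subseteq> gen a \<top>\<^bsub>M\<^esub>"
    unfolding inj1_def using assms ideal_gen gen_mem by (intro Inter_lower) auto
  show "gen a \<top>\<^bsub>M\<^esub> \<subseteq> inj1 L M a"
    unfolding inj1_def using gen_least by blast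
qed

lemma inj2_eq:
  assumes "b \<in> carrier M" shows "inj2 L M b = gen \<top>\<^bsub>L\<^esub> b"
proof
  show "inj2 L M b \<subseteq> gen \<top>\<^bsub>L\<^esub> b"
    unfolding inj2_def using assms ideal_gen gen_mem by (intro Inter_lower) auto
  show "gen \<top>\<^bsub>L\<^esub> b \<subseteq> inj2 L M b"
    unfolding inj2_def using gen_least by blast
qed

lemma rect_eq:
  assumes "a \<in> carrier L" "b \<in> carrier M"
  shows "rect L M a b = gen a b"
proof -
  have "rect L M a b = gen a \<top>\<^bsub>M\<^esub> \<inter> gen \<top>\<^bsub>L\<^esub> b"
    using assms ideal_gen by (simp add: rect_def inj1_eq inj2_eq tensor_meet)
  also have "\<dots> = gen a b"
    using L.top_higher M.top_higher by (auto simp: gen_def)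
  finally show ?thesis .
qed

text \<open>Every element is the join of the rectangles below it.\<close>

lemma tensor_generated:
  assumes "I \<in> carrier (tensor L M)"
  shows "I = \<Squnion>\<^bsub>tensor L M\<^esub>{rect L M a b |a b. a \<in> carrier L \<and> b \<in> carrier M \<and>
    rect L M a b \<sqsubseteq>\<^bsub>tensor L M\<^esub> I}" (is "I = \<Squnion>\<^bsub>tensor L M\<^esub>?S")
proof
  have I: "tensor_ideal L M I" using assms by simp
  have S: "?S \<subseteq> {I. tensor_ideal L M I}" by (auto simp: rect_eq ideal_gen)
  show "\<Squnion>\<^bsub>tensor L M\<^esub>?S \<subseteq> I" by (rule tensor_sup_least[OF S I]) auto
  show "I \<subseteq> \<Squnion>\<^bsub>tensor L M\<^esub>?S"
  proof clarify
    fix a b assume ab: "(a, b) \<in> I"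
    then have c: "a \<in> carrier L" "b \<in> carrier M" using I by (auto dest: tensor_idealD(1,2))
    then have "gen a b \<in> ?S" using gen_least[OF I ab] by (auto simp: rect_eq intro!: exI[of _ a] exI[of _ b])
    then show "(a, b) \<in> \<Squnion>\<^bsub>tensor L M\<^esub>?S" using tensor_sup_upper[OF S] gen_mem[OF c] by blast
  qed
qed

lemma frame_map_inj1: "frame_map L (tensor L M) (inj1 L M)"
  unfolding frame_map_def
proof (intro conjI)
  show "frame L" "frame (tensor L M)" by (rule L.frame_axioms frame_tensor)+
  show "inj1 L M \<in> carrier L \<rightarrow> carrier (tensor L M)" by (auto simp: inj1_eq ideal_gen)
  show "inj1 L M \<top>\<^bsub>L\<^esub> = \<top>\<^bsub>tensor L M\<^esub>"
    using L.top_higher M.top_higher by (auto simp: inj1_eq tensor_top gen_def)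
  show "meet_pres L (tensor L M) (inj1 L M)"
    unfolding meet_pres_def
  proof (intro conjI ballI)
    show "lattice L" "lattice (tensor L M)" by (rule L.lattice_axioms T.lattice_axioms)+
    fix x y assume c: "x \<in> carrier L" "y \<in> carrier L"
    have iff: "z \<sqsubseteq>\<^bsub>L\<^esub> x \<sqinter>\<^bsub>L\<^esub> y \<longleftrightarrow> z \<sqsubseteq>\<^bsub>L\<^esub> x \<and> z \<sqsubseteq>\<^bsub>L\<^esub> y" if "z \<in> carrier L" for z
      using c that L.meet_left L.meet_right L.meet_le L.le_trans L.meet_closed by meson
    show "inj1 L M (x \<sqinter>\<^bsub>L\<^esub> y) = inj1 L M x \<sqinter>\<^bsub>tensor L M\<^esub> inj1 L M y"
      using c by (simp add: inj1_eq tensor_meet ideal_gen) (auto simp: gen_def iff)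
  qed
  show "sup_pres L (tensor L M) (inj1 L M)"
    unfolding sup_pres_def
  proof (intro conjI allI impI)
    show "complete_lattice L" "complete_lattice (tensor L M)"
      by (rule L.complete_lattice_axioms complete_lattice_tensor)+
    fix A assume A: "A \<subseteq> carrier L"
    have im: "inj1 L M ` A \<subseteq> {I. tensor_ideal L M I}" using A by (auto simp: inj1_eq ideal_gen)
    show "inj1 L M (\<Squnion>\<^bsub>L\<^esub>A) = \<Squnion>\<^bsub>tensor L M\<^esub>(inj1 L M ` A)"
    proof
      have "(a, \<top>\<^bsub>M\<^esub>) \<in> \<Squnion>\<^bsub>tensor L M\<^esub>(inj1 L M ` A)" if "a \<in> A" for a
      proof -
        have a: "a \<in> carrier L" using that A by auto
        have "inj1 L M a \<subseteq> \<Squnion>\<^bsub>tensor L M\<^esub>(inj1 L M ` A)" using that by (intro tensor_sup_upper[OF im]) auto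
        then show ?thesis unfolding inj1_eq[OF a] using gen_mem[OF a M.top_closed] by (rule subsetD)
      qed
      then have "(\<Squnion>\<^bsub>L\<^esub>A, \<top>\<^bsub>M\<^esub>) \<in> \<Squnion>\<^bsub>tensor L M\<^esub>(inj1 L M ` A)"
        using A by (intro tensor_idealD(4)[OF tensor_sup_closed[OF im]]) auto
      then show "inj1 L M (\<Squnion>\<^bsub>L\<^esub>A) \<subseteq> \<Squnion>\<^bsub>tensor L M\<^esub>(inj1 L M ` A)"
        using A gen_least[OF tensor_sup_closed[OF im]] by (simp add: inj1_eq)
      show "\<Squnion>\<^bsub>tensor L M\<^esub>(inj1 L M ` A) \<subseteq> inj1 L M (\<Squnion>\<^bsub>L\<^esub>A)"
      proof (rule tensor_sup_least[OF im])
        show "tensor_ideal L M (inj1 L M (\<Squnion>\<^bsub>L\<^esub>A))" using A by (simp add: inj1_eq ideal_gen)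
        fix I assume "I \<in> inj1 L M ` A"
        then obtain a where a: "a \<in> A" "I = gen a \<top>\<^bsub>M\<^esub>" using A by (auto simp: inj1_eq)
        have "(a, \<top>\<^bsub>M\<^esub>) \<in> gen (\<Squnion>\<^bsub>L\<^esub>A) \<top>\<^bsub>M\<^esub>" using a A L.sup_upper[OF A] by (auto simp: gen_def)
        then show "I \<subseteq> inj1 L M (\<Squnion>\<^bsub>L\<^esub>A)"
          using a A gen_least[OF ideal_gen] by (simp add: inj1_eq)
      qed
    qed
  qed
qed

lemma frame_map_inj2: "frame_map M (tensor L M) (inj2 L M)"
  unfolding frame_map_def
proof (intro conjI)
  show "frame M" "frame (tensor L M)" by (rule M.frame_axioms frame_tensor)+
  show "inj2 L M \<in> carrier M \<rightarrow> carrier (tensor L M)" by (auto simp: inj2_eq ideal_gen)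
  show "inj2 L M \<top>\<^bsub>M\<^esub> = \<top>\<^bsub>tensor L M\<^esub>"
    using L.top_higher M.top_higher by (auto simp: inj2_eq tensor_top gen_def)
  show "meet_pres M (tensor L M) (inj2 L M)"
    unfolding meet_pres_def
  proof (intro conjI ballI)
    show "lattice M" "lattice (tensor L M)" by (rule M.lattice_axioms T.lattice_axioms)+
    fix x y assume c: "x \<in> carrier M" "y \<in> carrier M"
    have iff: "z \<sqsubseteq>\<^bsub>M\<^esub> x \<sqinter>\<^bsub>M\<^esub> y \<longleftrightarrow> z \<sqsubseteq>\<^bsub>M\<^esub> x \<and> z \<sqsubseteq>\<^bsub>M\<^esub> y" if "z \<in> carrier M" for z
      using c that M.meet_left M.meet_right M.meet_le M.le_trans M.meet_closed by meson
    show "inj2 L M (x \<sqinter>\<^bsub>M\<^esub> y) = inj2 L M x \<sqinter>\<^bsub>tensor L M\<^esub> inj2 L M y"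
      using c by (simp add: inj2_eq tensor_meet ideal_gen) (auto simp: gen_def iff)
  qed
  show "sup_pres M (tensor L M) (inj2 L M)"
    unfolding sup_pres_def
  proof (intro conjI allI impI)
    show "complete_lattice M" "complete_lattice (tensor L M)"
      by (rule M.complete_lattice_axioms complete_lattice_tensor)+
    fix A assume A: "A \<subseteq> carrier M"
    have im: "inj2 L M ` A \<subseteq> {I. tensor_ideal L M I}" using A by (auto simp: inj2_eq ideal_gen)
    show "inj2 L M (\<Squnion>\<^bsub>M\<^esub>A) = \<Squnion>\<^bsub>tensor L M\<^esub>(inj2 L M ` A)"
    proof
      have "(\<top>\<^bsub>L\<^esub>, a) \<in> \<Squnion>\<^bsub>tensor L M\<^esub>(inj2 L M ` A)" if "a \<in> A" for a
      proof -
        have a: "a \<in> carrier M" using that A by auto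
        have "inj2 L M a \<subseteq> \<Squnion>\<^bsub>tensor L M\<^esub>(inj2 L M ` A)" using that by (intro tensor_sup_upper[OF im]) auto
        then show ?thesis unfolding inj2_eq[OF a] using gen_mem[OF L.top_closed a] by (rule subsetD)
      qed
      then have "(\<top>\<^bsub>L\<^esub>, \<Squnion>\<^bsub>M\<^esub>A) \<in> \<Squnion>\<^bsub>tensor L M\<^esub>(inj2 L M ` A)"
        using A by (intro tensor_idealD(5)[OF tensor_sup_closed[OF im]]) auto
      then show "inj2 L M (\<Squnion>\<^bsub>M\<^esub>A) \<subseteq> \<Squnion>\<^bsub>tensor L M\<^esub>(inj2 L M ` A)"
        using A gen_least[OF tensor_sup_closed[OF im]] by (simp add: inj2_eq)
      show "\<Squnion>\<^bsub>tensor L M\<^esub>(inj2 L M ` A) \<subseteq> inj2 L M (\<Squnion>\<^bsub>M\<^esub>A)"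
      proof (rule tensor_sup_least[OF im])
        show "tensor_ideal L M (inj2 L M (\<Squnion>\<^bsub>M\<^esub>A))" using A by (simp add: inj2_eq ideal_gen)
        fix I assume "I \<in> inj2 L M ` A"
        then obtain a where a: "a \<in> A" "I = gen \<top>\<^bsub>L\<^esub> a" using A by (auto simp: inj2_eq)
        have "(\<top>\<^bsub>L\<^esub>, a) \<in> gen \<top>\<^bsub>L\<^esub> (\<Squnion>\<^bsub>M\<^esub>A)" using a A M.sup_upper[OF A] by (auto simp: gen_def)
        then show "I \<subseteq> inj2 L M (\<Squnion>\<^bsub>M\<^esub>A)"
          using a A gen_least[OF ideal_gen] by (simp add: inj2_eq)
      qed
    qed
  qed
qed

lemma tensor_universal:
  assumes f: "frame_map L N f" and g: "frame_map M N g"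
  shows "\<exists>h. frame_map (tensor L M) N h \<and>
    (\<forall>x\<in>carrier L. h (inj1 L M x) = f x) \<and> (\<forall>y\<in>carrier M. h (inj2 L M y) = g y)"
proof -
  interpret N: frame N using f by (simp add: frame_map_def)
  have fc: "f x \<in> carrier N" if "x \<in> carrier L" for x
    using f that by (auto simp: frame_map_def)
  have gc: "g y \<in> carrier N" if "y \<in> carrier M" for y
    using g that by (auto simp: frame_map_def)
  have f_meet: "f (x \<sqinter>\<^bsub>L\<^esub> y) = f x \<sqinter>\<^bsub>N\<^esub> f y" if "x \<in> carrier L" "y \<in> carrier L" for x y
    using f that by (auto simp: frame_map_def meet_pres_def)
  have g_meet: "g (x \<sqinter>\<^bsub>M\<^esub> y) = g x \<sqinter>\<^bsub>N\<^esub> g y" if "x \<in> carrier M" "y \<in> carrier M" for x y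
    using g that by (auto simp: frame_map_def meet_pres_def)
  have f_sup: "f (\<Squnion>\<^bsub>L\<^esub>A) = \<Squnion>\<^bsub>N\<^esub>(f ` A)" if "A \<subseteq> carrier L" for A
    using f that by (auto simp: frame_map_def sup_pres_def)
  have g_sup: "g (\<Squnion>\<^bsub>M\<^esub>B) = \<Squnion>\<^bsub>N\<^esub>(g ` B)" if "B \<subseteq> carrier M" for B
    using g that by (auto simp: frame_map_def sup_pres_def)
  have f_mono: "f x \<sqsubseteq>\<^bsub>N\<^esub> f y" if "x \<in> carrier L" "y \<in> carrier L" "x \<sqsubseteq>\<^bsub>L\<^esub> y" for x y
    using f that meet_pres_isotone[of f L N] by (auto simp: frame_map_def isotone_def)
  have g_mono: "g x \<sqsubseteq>\<^bsub>N\<^esub> g y" if "x \<in> carrier M" "y \<in> carrier M" "x \<sqsubseteq>\<^bsub>M\<^esub> y" for x y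
    using g that meet_pres_isotone[of g M N] by (auto simp: frame_map_def isotone_def)
  have f_top: "f \<top>\<^bsub>L\<^esub> = \<top>\<^bsub>N\<^esub>" and g_top: "g \<top>\<^bsub>M\<^esub> = \<top>\<^bsub>N\<^esub>"
    using f g by (auto simp: frame_map_def)
  have meet_mono: "a \<sqinter>\<^bsub>N\<^esub> b \<sqsubseteq>\<^bsub>N\<^esub> c \<sqinter>\<^bsub>N\<^esub> d"
    if "a \<in> carrier N" "b \<in> carrier N" "c \<in> carrier N" "d \<in> carrier N" "a \<sqsubseteq>\<^bsub>N\<^esub> c" "b \<sqsubseteq>\<^bsub>N\<^esub> d"
    for a b c d
    using that N.le_trans[OF N.meet_left[of a b], of c] N.le_trans[OF N.meet_right[of a b], of d]
    by (intro N.meet_le) auto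
  have meet_comm: "a \<sqinter>\<^bsub>N\<^esub> b = b \<sqinter>\<^bsub>N\<^esub> a" for a b
    by (simp add: meet_def insert_commute)
  have meet_top: "a \<sqinter>\<^bsub>N\<^esub> \<top>\<^bsub>N\<^esub> = a" "\<top>\<^bsub>N\<^esub> \<sqinter>\<^bsub>N\<^esub> a = a" if "a \<in> carrier N" for a
    using that N.le_antisym[of "a \<sqinter>\<^bsub>N\<^esub> \<top>\<^bsub>N\<^esub>" a] N.le_antisym[of "\<top>\<^bsub>N\<^esub> \<sqinter>\<^bsub>N\<^esub> a" a]
      N.meet_left[of a "\<top>\<^bsub>N\<^esub>"] N.meet_right[of "\<top>\<^bsub>N\<^esub>" a] N.top_higher[of a]
      N.meet_le[of a a "\<top>\<^bsub>N\<^esub>"] N.meet_le[of a "\<top>\<^bsub>N\<^esub>" a] by auto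

  define F where "F = (\<lambda>(x, y). f x \<sqinter>\<^bsub>N\<^esub> g y)"
  define h where "h = (\<lambda>I. \<Squnion>\<^bsub>N\<^esub>(F ` I))"
  define adj where "adj = (\<lambda>n. {(x, y). x \<in> carrier L \<and> y \<in> carrier M \<and> f x \<sqinter>\<^bsub>N\<^esub> g y \<sqsubseteq>\<^bsub>N\<^esub> n})"
  have FI: "F ` I \<subseteq> carrier N" if "tensor_ideal L M I" for I
    using tensor_idealD(1,2)[OF that] fc gc by (auto simp: F_def)
  have hc: "h I \<in> carrier N" if "tensor_ideal L M I" for I
    using FI[OF that] by (simp add: h_def)
  have adj: "tensor_ideal L M (adj n)" if n: "n \<in> carrier N" for n
  proof (rule tensor_idealI)
    fix a b x y
    assume *: "(a, b) \<in> adj n" "x \<in> carrier L" "y \<in> carrier M" "x \<sqsubseteq>\<^bsub>L\<^esub> a" "y \<sqsubseteq>\<^bsub>M\<^esub> b"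
    then have ab: "a \<in> carrier L" "b \<in> carrier M" "f a \<sqinter>\<^bsub>N\<^esub> g b \<sqsubseteq>\<^bsub>N\<^esub> n" by (auto simp: adj_def)
    have "f x \<sqinter>\<^bsub>N\<^esub> g y \<sqsubseteq>\<^bsub>N\<^esub> f a \<sqinter>\<^bsub>N\<^esub> g b"
      using * ab by (intro meet_mono f_mono g_mono fc gc)
    then have "f x \<sqinter>\<^bsub>N\<^esub> g y \<sqsubseteq>\<^bsub>N\<^esub> n"
      using ab * n fc gc N.le_trans[of "f x \<sqinter>\<^bsub>N\<^esub> g y" "f a \<sqinter>\<^bsub>N\<^esub> g b" n] by simp
    then show "(x, y) \<in> adj n" using * by (simp add: adj_def)
  next
    fix A b assume *: "A \<subseteq> carrier L" "b \<in> carrier M" "\<And>a. a \<in> A \<Longrightarrow> (a, b) \<in> adj n"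
    have im: "f ` A \<subseteq> carrier N" using * fc by auto
    have "f (\<Squnion>\<^bsub>L\<^esub>A) \<sqinter>\<^bsub>N\<^esub> g b = g b \<sqinter>\<^bsub>N\<^esub> \<Squnion>\<^bsub>N\<^esub>(f ` A)"
      using * f_sup meet_comm by simp
    also have "\<dots> = \<Squnion>\<^bsub>N\<^esub>((\<lambda>c. g b \<sqinter>\<^bsub>N\<^esub> c) ` f ` A)"
      using * im gc by (simp add: N.meet_sup_distrib)
    also have "\<dots> \<sqsubseteq>\<^bsub>N\<^esub> n"
    proof (rule N.sup_least)
      fix z assume "z \<in> (\<lambda>c. g b \<sqinter>\<^bsub>N\<^esub> c) ` f ` A"
      then obtain a where a: "a \<in> A" "z = g b \<sqinter>\<^bsub>N\<^esub> f a" by blast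
      then show "z \<sqsubseteq>\<^bsub>N\<^esub> n" using *(3)[OF a(1)] meet_comm by (simp add: adj_def)
    qed (use n im gc * in auto)
    finally show "(\<Squnion>\<^bsub>L\<^esub>A, b) \<in> adj n" using * by (simp add: adj_def)
  next
    fix a B assume *: "a \<in> carrier L" "B \<subseteq> carrier M" "\<And>b. b \<in> B \<Longrightarrow> (a, b) \<in> adj n"
    have im: "g ` B \<subseteq> carrier N" using * gc by auto
    have "f a \<sqinter>\<^bsub>N\<^esub> g (\<Squnion>\<^bsub>M\<^esub>B) = \<Squnion>\<^bsub>N\<^esub>((\<lambda>c. f a \<sqinter>\<^bsub>N\<^esub> c) ` g ` B)"
      using * im fc g_sup by (simp add: N.meet_sup_distrib)
    also have "\<dots> \<sqsubseteq>\<^bsub>N\<^esub> n"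
    proof (rule N.sup_least)
      fix z assume "z \<in> (\<lambda>c. f a \<sqinter>\<^bsub>N\<^esub> c) ` g ` B"
      then obtain b where b: "b \<in> B" "z = f a \<sqinter>\<^bsub>N\<^esub> g b" by blast
      then show "z \<sqsubseteq>\<^bsub>N\<^esub> n" using *(3)[OF b(1)] by (simp add: adj_def)
    qed (use n im fc * in auto)
    finally show "(a, \<Squnion>\<^bsub>M\<^esub>B) \<in> adj n" using * by (simp add: adj_def)
  qed (auto simp: adj_def)
  have h_le: "h I \<sqsubseteq>\<^bsub>N\<^esub> n" if "tensor_ideal L M I" "n \<in> carrier N" "I \<subseteq> adj n" for I n
    unfolding h_def by (rule N.sup_least[OF FI]) (use that in \<open>auto simp: F_def adj_def\<close>)
  have F_le: "f x \<sqinter>\<^bsub>N\<^esub> g y \<sqsubseteq>\<^bsub>N\<^esub> h I" if "tensor_ideal L M I" "(x, y) \<in> I" for I x y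
  proof -
    have "F (x, y) \<in> F ` I" using that(2) by (rule imageI)
    from N.sup_upper[OF FI[OF that(1)] this] show ?thesis by (simp add: h_def F_def)
  qed
  have le_adj: "I \<subseteq> adj n" if "tensor_ideal L M I" "n \<in> carrier N" "h I \<sqsubseteq>\<^bsub>N\<^esub> n" for I n
  proof clarify
    fix x y assume xy: "(x, y) \<in> I"
    then have c: "x \<in> carrier L" "y \<in> carrier M" using tensor_idealD(1,2)[OF that(1)] by auto
    then show "(x, y) \<in> adj n"
      using N.le_trans[OF F_le[OF that(1) xy] that(3)] hc[OF that(1)] that(2) fc gc
      by (simp add: adj_def)
  qed
  have h_mono: "h I \<sqsubseteq>\<^bsub>N\<^esub> h J" if "tensor_ideal L M I" "tensor_ideal L M J" "I \<subseteq> J" for I J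
    using h_le[OF that(1) hc[OF that(2)]] le_adj[OF that(2) hc[OF that(2)]] that hc by auto
  have h_gen: "h (gen x y) = f x \<sqinter>\<^bsub>N\<^esub> g y" if c: "x \<in> carrier L" "y \<in> carrier M" for x y
  proof (rule N.le_antisym)
    have "(x, y) \<in> adj (f x \<sqinter>\<^bsub>N\<^esub> g y)" using c fc gc by (simp add: adj_def)
    then show "h (gen x y) \<sqsubseteq>\<^bsub>N\<^esub> f x \<sqinter>\<^bsub>N\<^esub> g y"
      using c fc gc by (intro h_le ideal_gen gen_least adj) auto
    show "f x \<sqinter>\<^bsub>N\<^esub> g y \<sqsubseteq>\<^bsub>N\<^esub> h (gen x y)"
      using c by (intro F_le ideal_gen gen_mem)
  qed (use c fc gc hc ideal_gen in auto)
  have "frame_map (tensor L M) N h"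
    unfolding frame_map_def
  proof (intro conjI)
    show "frame (tensor L M)" "frame N" by (rule frame_tensor N.frame_axioms)+
    show "h \<in> carrier (tensor L M) \<rightarrow> carrier N" using hc by auto
    have "\<top>\<^bsub>tensor L M\<^esub> = gen \<top>\<^bsub>L\<^esub> \<top>\<^bsub>M\<^esub>"
      using L.top_higher M.top_higher by (auto simp: tensor_top gen_def)
    then show "h \<top>\<^bsub>tensor L M\<^esub> = \<top>\<^bsub>N\<^esub>" by (simp add: h_gen f_top g_top meet_top)
    show "meet_pres (tensor L M) N h"
      unfolding meet_pres_def
    proof (intro conjI ballI)
      show "lattice (tensor L M)" "lattice N" by (rule T.lattice_axioms N.lattice_axioms)+
      fix I J assume "I \<in> carrier (tensor L M)" "J \<in> carrier (tensor L M)"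
      then have IJ: "tensor_ideal L M I" "tensor_ideal L M J" "tensor_ideal L M (I \<inter> J)"
        using ideal_Int by auto
      have mid: "F p \<sqinter>\<^bsub>N\<^esub> F q \<sqsubseteq>\<^bsub>N\<^esub> h (I \<inter> J)" if pq: "p \<in> I" "q \<in> J" for p q
      proof -
        obtain a b c d where e: "p = (a, b)" "q = (c, d)" by fastforce
        have cs: "a \<in> carrier L" "b \<in> carrier M" "c \<in> carrier L" "d \<in> carrier M"
          using e pq tensor_idealD(1,2)[OF IJ(1)] tensor_idealD(1,2)[OF IJ(2)] by auto
        have "(a \<sqinter>\<^bsub>L\<^esub> c, b \<sqinter>\<^bsub>M\<^esub> d) \<in> I"
          by (rule tensor_idealD(3)[OF IJ(1), of a b]) (use cs e pq L.meet_left M.meet_left in auto)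
        moreover have "(a \<sqinter>\<^bsub>L\<^esub> c, b \<sqinter>\<^bsub>M\<^esub> d) \<in> J"
          by (rule tensor_idealD(3)[OF IJ(2), of c d]) (use cs e pq L.meet_right M.meet_right in auto)
        ultimately have "f (a \<sqinter>\<^bsub>L\<^esub> c) \<sqinter>\<^bsub>N\<^esub> g (b \<sqinter>\<^bsub>M\<^esub> d) \<sqsubseteq>\<^bsub>N\<^esub> h (I \<inter> J)"
          by (intro F_le IJ) auto
        moreover have "F p \<sqinter>\<^bsub>N\<^esub> F q = f (a \<sqinter>\<^bsub>L\<^esub> c) \<sqinter>\<^bsub>N\<^esub> g (b \<sqinter>\<^bsub>M\<^esub> d)"
        proof -
          note k = fc[OF cs(1)] gc[OF cs(2)] fc[OF cs(3)] gc[OF cs(4)]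
          have "g b \<sqinter>\<^bsub>N\<^esub> (f c \<sqinter>\<^bsub>N\<^esub> g d) = f c \<sqinter>\<^bsub>N\<^esub> (g b \<sqinter>\<^bsub>N\<^esub> g d)"
            using k N.meet_assoc[of "g b" "f c" "g d"] N.meet_assoc[of "f c" "g b" "g d"]
              meet_comm[of "g b" "f c"] by simp
          then show ?thesis using k cs by (simp add: F_def e f_meet g_meet N.meet_assoc)
        qed
        ultimately show ?thesis by simp
      qed
      have part: "h I \<sqinter>\<^bsub>N\<^esub> F q \<sqsubseteq>\<^bsub>N\<^esub> h (I \<inter> J)" if q: "q \<in> J" for q
      proof -
        have qc: "F q \<in> carrier N" using FI[OF IJ(2)] q by auto
        have "h I \<sqinter>\<^bsub>N\<^esub> F q = \<Squnion>\<^bsub>N\<^esub>((\<lambda>z. F q \<sqinter>\<^bsub>N\<^esub> z) ` F ` I)"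
          using N.meet_sup_distrib[OF qc FI[OF IJ(1)]] meet_comm by (simp add: h_def)
        also have "\<dots> \<sqsubseteq>\<^bsub>N\<^esub> h (I \<inter> J)"
        proof (rule N.sup_least)
          show "(\<lambda>z. F q \<sqinter>\<^bsub>N\<^esub> z) ` F ` I \<subseteq> carrier N" using qc FI[OF IJ(1)] by auto
          fix z assume "z \<in> (\<lambda>z. F q \<sqinter>\<^bsub>N\<^esub> z) ` F ` I"
          then obtain p where "p \<in> I" "z = F q \<sqinter>\<^bsub>N\<^esub> F p" by blast
          then show "z \<sqsubseteq>\<^bsub>N\<^esub> h (I \<inter> J)" using mid[OF _ q] meet_comm by simp
        qed (rule hc[OF IJ(3)])
        finally show ?thesis .
      qed
      have "h I \<sqinter>\<^bsub>N\<^esub> h J \<sqsubseteq>\<^bsub>N\<^esub> h (I \<inter> J)"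
      proof -
        have "h I \<sqinter>\<^bsub>N\<^esub> h J = \<Squnion>\<^bsub>N\<^esub>((\<lambda>z. h I \<sqinter>\<^bsub>N\<^esub> z) ` F ` J)"
          using N.meet_sup_distrib[OF hc[OF IJ(1)] FI[OF IJ(2)]] by (simp add: h_def)
        also have "\<dots> \<sqsubseteq>\<^bsub>N\<^esub> h (I \<inter> J)"
        proof (rule N.sup_least)
          show "(\<lambda>z. h I \<sqinter>\<^bsub>N\<^esub> z) ` F ` J \<subseteq> carrier N" using hc[OF IJ(1)] FI[OF IJ(2)] by auto
          fix z assume "z \<in> (\<lambda>z. h I \<sqinter>\<^bsub>N\<^esub> z) ` F ` J"
          then show "z \<sqsubseteq>\<^bsub>N\<^esub> h (I \<inter> J)" using part by auto
        qed (rule hc[OF IJ(3)])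
        finally show ?thesis .
      qed
      moreover have "h (I \<inter> J) \<sqsubseteq>\<^bsub>N\<^esub> h I \<sqinter>\<^bsub>N\<^esub> h J"
        using IJ by (intro N.meet_le h_mono hc) auto
      ultimately have "h (I \<inter> J) = h I \<sqinter>\<^bsub>N\<^esub> h J"
        using IJ hc by (intro N.le_antisym) auto
      then show "h (I \<sqinter>\<^bsub>tensor L M\<^esub> J) = h I \<sqinter>\<^bsub>N\<^esub> h J" by (simp add: tensor_meet IJ)
    qed
    show "sup_pres (tensor L M) N h"
      unfolding sup_pres_def
    proof (intro conjI allI impI)
      show "complete_lattice (tensor L M)" "complete_lattice N"
        by (rule complete_lattice_tensor N.complete_lattice_axioms)+
      fix S assume "S \<subseteq> carrier (tensor L M)"
      then have S: "S \<subseteq> {I. tensor_ideal L M I}" by simp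
      then have im: "h ` S \<subseteq> carrier N" using hc by auto
      note sup = tensor_sup_closed[OF S]
      show "h (\<Squnion>\<^bsub>tensor L M\<^esub>S) = \<Squnion>\<^bsub>N\<^esub>(h ` S)"
      proof (rule N.le_antisym)
        show "h (\<Squnion>\<^bsub>tensor L M\<^esub>S) \<sqsubseteq>\<^bsub>N\<^esub> \<Squnion>\<^bsub>N\<^esub>(h ` S)"
        proof (rule h_le[OF sup])
          show c: "\<Squnion>\<^bsub>N\<^esub>(h ` S) \<in> carrier N" using im by simp
          show "\<Squnion>\<^bsub>tensor L M\<^esub>S \<subseteq> adj (\<Squnion>\<^bsub>N\<^esub>(h ` S))"
          proof (rule tensor_sup_least[OF S adj[OF c]])
            fix I assume I: "I \<in> S"
            then have "tensor_ideal L M I" using S by auto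
            then show "I \<subseteq> adj (\<Squnion>\<^bsub>N\<^esub>(h ` S))"
              by (rule le_adj[OF _ c N.sup_upper[OF im imageI[OF I]]])
          qed
        qed
        show "\<Squnion>\<^bsub>N\<^esub>(h ` S) \<sqsubseteq>\<^bsub>N\<^esub> h (\<Squnion>\<^bsub>tensor L M\<^esub>S)"
        proof (rule N.sup_least[OF im hc[OF sup]])
          fix z assume "z \<in> h ` S"
          then obtain I where I: "I \<in> S" "z = h I" by blast
          then have "tensor_ideal L M I" using S by auto
          then show "z \<sqsubseteq>\<^bsub>N\<^esub> h (\<Squnion>\<^bsub>tensor L M\<^esub>S)"
            using h_mono[OF _ sup tensor_sup_upper[OF S I(1)]] I by simp
        qed
      qed (use im hc sup in auto)
    qed
  qed
  moreover have "\<forall>x\<in>carrier L. h (inj1 L M x) = f x"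
    by (simp add: inj1_eq h_gen g_top meet_top fc)
  moreover have "\<forall>y\<in>carrier M. h (inj2 L M y) = g y"
    by (simp add: inj2_eq h_gen f_top meet_top gc)
  ultimately show ?thesis by blast
qed

lemma tensor_universal_unique:
  assumes h: "frame_map (tensor L M) N h" and k: "frame_map (tensor L M) N k"
    and eq1: "\<And>x. x \<in> carrier L \<Longrightarrow> h (inj1 L M x) = k (inj1 L M x)"
    and eq2: "\<And>y. y \<in> carrier M \<Longrightarrow> h (inj2 L M y) = k (inj2 L M y)"
    and I: "I \<in> carrier (tensor L M)"
  shows "h I = k I"
proof -
  let ?S = "{rect L M a b |a b. a \<in> carrier L \<and> b \<in> carrier M \<and> rect L M a b \<sqsubseteq>\<^bsub>tensor L M\<^esub> I}"
  have S: "?S \<subseteq> carrier (tensor L M)" by (auto simp: rect_eq ideal_gen)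
  have rect: "h (rect L M a b) = k (rect L M a b)" if c: "a \<in> carrier L" "b \<in> carrier M" for a b
  proof -
    have "inj1 L M a \<in> carrier (tensor L M)" "inj2 L M b \<in> carrier (tensor L M)"
      using c by (auto simp: inj1_eq inj2_eq ideal_gen)
    then show ?thesis
      using h k eq1[OF c(1)] eq2[OF c(2)] unfolding frame_map_def meet_pres_def rect_def by metis
  qed
  have "h ` ?S = k ` ?S" by (rule image_cong) (use rect in auto)
  moreover have "h (\<Squnion>\<^bsub>tensor L M\<^esub>?S) = \<Squnion>\<^bsub>N\<^esub>(h ` ?S)" "k (\<Squnion>\<^bsub>tensor L M\<^esub>?S) = \<Squnion>\<^bsub>N\<^esub>(k ` ?S)"
    using h k S unfolding frame_map_def sup_pres_def by blast+
  ultimately show ?thesis using tensor_generated[OF I] by simp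
qed

end


section \<open>Localic relations and open cones\<close>

text \<open>
  A localic relation on the locale with opens \<open>X\<close> is given by the frame of opens \<open>R\<close> of its
  domain and the surjective frame map \<open>r\<close> of the inclusion into the product.
\<close>

definition localic_relation :: "'a gorder \<Rightarrow> 'r gorder \<Rightarrow> (('a \<times> 'a) set \<Rightarrow> 'r) \<Rightarrow> bool" where
  "localic_relation X R r \<longleftrightarrow>
     frame_map (tensor X X) R r \<and> r ` carrier (tensor X X) = carrier R"

text \<open>The frame maps of the source and target maps.\<close>

definition source :: "'a gorder \<Rightarrow> (('a \<times> 'a) set \<Rightarrow> 'r) \<Rightarrow> 'a \<Rightarrow> 'r" where
  "source X r = r \<circ> inj1 X X"

definition target :: "'a gorder \<Rightarrow> (('a \<times> 'a) set \<Rightarrow> 'r) \<Rightarrow> 'a \<Rightarrow> 'r" where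
  "target X r = r \<circ> inj2 X X"

definition has_open_cones :: "'a gorder \<Rightarrow> 'r gorder \<Rightarrow> (('a \<times> 'a) set \<Rightarrow> 'r) \<Rightarrow> bool" where
  "has_open_cones X R r \<longleftrightarrow> open_map X R (source X r) \<and> open_map X R (target X r)"

definition up_cone :: "'a gorder \<Rightarrow> 'r gorder \<Rightarrow> (('a \<times> 'a) set \<Rightarrow> 'r) \<Rightarrow> 'a \<Rightarrow> 'a" where
  "up_cone X R r = direct_image X R (target X r) \<circ> source X r"

definition down_cone :: "'a gorder \<Rightarrow> 'r gorder \<Rightarrow> (('a \<times> 'a) set \<Rightarrow> 'r) \<Rightarrow> 'a \<Rightarrow> 'a" where
  "down_cone X R r = direct_image X R (source X r) \<circ> target X r"


section \<open>Parallel pairs and the relation they induce\<close>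

definition parallel :: "'a gorder \<Rightarrow> ('a \<Rightarrow> 'a) \<Rightarrow> ('a \<Rightarrow> 'a) \<Rightarrow> bool" where
  "parallel L u d \<longleftrightarrow>
     u \<in> carrier L \<rightarrow> carrier L \<and> d \<in> carrier L \<rightarrow> carrier L \<and>
     (\<forall>x\<in>carrier L. \<forall>y\<in>carrier L.
        u x \<sqinter>\<^bsub>L\<^esub> y \<sqsubseteq>\<^bsub>L\<^esub> u (x \<sqinter>\<^bsub>L\<^esub> d y) \<and>
        x \<sqinter>\<^bsub>L\<^esub> d y \<sqsubseteq>\<^bsub>L\<^esub> d (u x \<sqinter>\<^bsub>L\<^esub> y))"

text \<open>
  For \<open>u\<close> and \<open>d\<close> preserving joins, the two conditions do not depend on the sides chosen for the
  rectangles: a rectangle determines its sides unless one of them is bottom, and then both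
  meets formed from it are bottom.
\<close>

definition rect_rel ::
  "'a gorder \<Rightarrow> ('a \<Rightarrow> 'a) \<Rightarrow> ('a \<Rightarrow> 'a) \<Rightarrow> ('a \<times> 'a) set \<Rightarrow> ('a \<times> 'a) set \<Rightarrow> bool" where
  "rect_rel X u d p q \<longleftrightarrow>
     (\<exists>a\<in>carrier X. \<exists>b\<in>carrier X. \<exists>a'\<in>carrier X. \<exists>b'\<in>carrier X.
        p = rect X X a b \<and> q = rect X X a' b' \<and>
        u a \<sqinter>\<^bsub>X\<^esub> b = u a' \<sqinter>\<^bsub>X\<^esub> b' \<and> a \<sqinter>\<^bsub>X\<^esub> d b = a' \<sqinter>\<^bsub>X\<^esub> d b')"

definition saturated :: "'a gorder \<Rightarrow> ('a \<Rightarrow> 'a) \<Rightarrow> ('a \<Rightarrow> 'a) \<Rightarrow> ('a \<times> 'a) set set" where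
  "saturated X u d =
     {o' \<in> carrier (tensor X X). \<forall>p q. rect_rel X u d p q \<longrightarrow>
        (\<forall>w\<in>carrier (tensor X X).
           p \<sqinter>\<^bsub>tensor X X\<^esub> w \<sqsubseteq>\<^bsub>tensor X X\<^esub> o' \<longleftrightarrow> q \<sqinter>\<^bsub>tensor X X\<^esub> w \<sqsubseteq>\<^bsub>tensor X X\<^esub> o')}"

definition induced_frame ::
  "'a gorder \<Rightarrow> ('a \<Rightarrow> 'a) \<Rightarrow> ('a \<Rightarrow> 'a) \<Rightarrow> ('a \<times> 'a) set gorder" where
  "induced_frame X u d = (tensor X X)\<lparr>carrier := saturated X u d\<rparr>"

definition saturation ::
  "'a gorder \<Rightarrow> ('a \<Rightarrow> 'a) \<Rightarrow> ('a \<Rightarrow> 'a) \<Rightarrow> ('a \<times> 'a) set \<Rightarrow> ('a \<times> 'a) set" where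
  "saturation X u d w =
     (THE m. least (tensor X X) m {o' \<in> saturated X u d. w \<sqsubseteq>\<^bsub>tensor X X\<^esub> o'})"

end

theory Submission
  imports Defs
begin

text \<open>
  The relation \<open>\<sim>\<close> is stable under meets with rectangles, so an element of the tensor product, seen
  as a set of pairs, is saturated iff it contains with a pair all pairs related to it. Since
  \<open>a \<otimes> b \<sim> a \<otimes> (u a \<sqinter> b)\<close>, the target map sends \<open>y\<close> to the set of all \<open>(a, b)\<close> with
  \<open>u a \<sqinter> b \<sqsubseteq> y\<close>. In this form its left adjoint is visibly the map sending a saturated set to the
  join of all \<open>u a \<sqinter> b\<close> with \<open>(a, b)\<close> in it. Likewise the source map sends \<open>x\<close> to the set of all
  \<open>(a, b)\<close> with \<open>a \<sqinter> d b \<sqsubseteq> x\<close>, and \<open>u a \<sqinter> b \<sqsubseteq> u (a \<sqinter> d b)\<close> identifies the cones.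
\<close>

section \<open>Meets in frames\<close>

context frame
begin

lemma meet_commute: "x \<sqinter> y = y \<sqinter> x"
  by (simp add: meet_def insert_commute)

lemma le_meet_iff:
  "\<lbrakk>x \<in> carrier L; y \<in> carrier L; z \<in> carrier L\<rbrakk> \<Longrightarrow> z \<sqsubseteq> x \<sqinter> y \<longleftrightarrow> z \<sqsubseteq> x \<and> z \<sqsubseteq> y"
  using meet_left meet_right meet_le le_trans meet_closed by meson

lemma meet_eq_left: "\<lbrakk>x \<in> carrier L; y \<in> carrier L; x \<sqsubseteq> y\<rbrakk> \<Longrightarrow> x \<sqinter> y = x"
  using le_iff_join[of x y] by simp

lemma meet_eq_right: "\<lbrakk>x \<in> carrier L; y \<in> carrier L; y \<sqsubseteq> x\<rbrakk> \<Longrightarrow> x \<sqinter> y = y"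
  using meet_eq_left[of y x] meet_commute by simp

lemma meet_mono:
  assumes "a \<in> carrier L" "b \<in> carrier L" "c \<in> carrier L" "d \<in> carrier L" "a \<sqsubseteq> c" "b \<sqsubseteq> d"
  shows "a \<sqinter> b \<sqsubseteq> c \<sqinter> d"
  using assms le_trans[OF meet_left[of a b], of c] le_trans[OF meet_right[of a b], of d]
  by (intro meet_le) auto

lemma sup_meet_distrib:
  "\<lbrakk>x \<in> carrier L; Y \<subseteq> carrier L\<rbrakk> \<Longrightarrow> \<Squnion>Y \<sqinter> x = \<Squnion>((\<lambda>y. y \<sqinter> x) ` Y)"
  using meet_sup_distrib[of x Y] meet_commute by simp

end

lemma frame_map_compose:
  assumes f: "frame_map L M f" and g: "frame_map M N g"
  shows "frame_map L N (g \<circ> f)"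
  unfolding frame_map_def
proof (intro conjI)
  have fc: "f x \<in> carrier M" if "x \<in> carrier L" for x
    using f that by (auto simp: frame_map_def)
  show "frame L" "frame N" "(g \<circ> f) \<top>\<^bsub>L\<^esub> = \<top>\<^bsub>N\<^esub>"
    using f g by (simp_all add: frame_map_def)
  show "g \<circ> f \<in> carrier L \<rightarrow> carrier N"
    using f g by (auto simp: frame_map_def)
  show "meet_pres L N (g \<circ> f)"
    using f g fc by (simp add: frame_map_def meet_pres_def)
  have "f ` A \<subseteq> carrier M" if "A \<subseteq> carrier L" for A using that fc by auto
  then show "sup_pres L N (g \<circ> f)"
    using f g by (simp add: frame_map_def sup_pres_def image_comp)
qed

text \<open>Frees \<open>direct_image\<close> from its choice operator: any explicit left adjoint
  computes it. Uniqueness of adjoints holds only on the carrier, hence the condition on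
  \<open>y\<close>.\<close>

lemma direct_image_eq:
  assumes "left_adjoint L M f g" "y \<in> carrier M"
  shows "direct_image L M f y = g y"
  using assms left_adjoint_unique[OF someI[of "left_adjoint L M f", OF assms(1)] assms]
  by (simp add: direct_image_def)

section \<open>The relation on rectangles and saturated elements\<close>

locale join_parallel_pair = X: frame X for X :: "'a gorder" (structure) +
  fixes u d :: "'a \<Rightarrow> 'a"
  assumes par: "parallel X u d"
    and sup_u: "sup_pres X X u" and sup_d: "sup_pres X X d"
begin

sublocale P: frame_pair X X
  by (intro frame_pair.intro X.frame_axioms)

lemma u_closed [simp]: "x \<in> carrier X \<Longrightarrow> u x \<in> carrier X"
  and d_closed [simp]: "x \<in> carrier X \<Longrightarrow> d x \<in> carrier X"
  using par by (auto simp: parallel_def)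

lemma parallel_u: "\<lbrakk>x \<in> carrier X; y \<in> carrier X\<rbrakk> \<Longrightarrow> u x \<sqinter> y \<sqsubseteq> u (x \<sqinter> d y)"
  and parallel_d: "\<lbrakk>x \<in> carrier X; y \<in> carrier X\<rbrakk> \<Longrightarrow> x \<sqinter> d y \<sqsubseteq> d (u x \<sqinter> y)"
  using par by (auto simp: parallel_def)

lemma u_mono: "\<lbrakk>x \<in> carrier X; y \<in> carrier X; x \<sqsubseteq> y\<rbrakk> \<Longrightarrow> u x \<sqsubseteq> u y"
  using join_pres_isotone[OF _ sup_pres_is_join_pres[OF weak_sup_pres[OF sup_u]]]
  by (auto simp: isotone_def)

lemma d_mono: "\<lbrakk>x \<in> carrier X; y \<in> carrier X; x \<sqsubseteq> y\<rbrakk> \<Longrightarrow> d x \<sqsubseteq> d y"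
  using join_pres_isotone[OF _ sup_pres_is_join_pres[OF weak_sup_pres[OF sup_d]]]
  by (auto simp: isotone_def)

text \<open>This is the condition inside \<open>rect_rel\<close> for fixed sides. Working with pairs
  of sides avoids the existential choice of sides and suits tensor ideals, which are sets of
  pairs.\<close>

definition rel :: "'a \<Rightarrow> 'a \<Rightarrow> 'a \<Rightarrow> 'a \<Rightarrow> bool" where
  "rel a b a' b' \<longleftrightarrow> u a \<sqinter> b = u a' \<sqinter> b' \<and> a \<sqinter> d b = a' \<sqinter> d b'"

section \<open>Stability of the relation under meets with rectangles\<close>

lemma rel_sym: "rel a b a' b' \<Longrightarrow> rel a' b' a b"
  by (simp add: rel_def)

text \<open>Parallelism moves \<open>b\<close> under \<open>u\<close> as a meet with
  \<open>d b\<close>. There \<open>a \<sqinter> d b\<close> appears, which \<open>rel\<close> allows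
  to be exchanged for \<open>a' \<sqinter> d b'\<close>. The bound by \<open>b'\<close> comes from
  dropping \<open>x\<close> and exchanging \<open>u a \<sqinter> b\<close>.\<close>

lemma rel_meet_left_le:
  assumes c: "a \<in> carrier X" "b \<in> carrier X" "a' \<in> carrier X" "b' \<in> carrier X" "x \<in> carrier X"
    and r: "rel a b a' b'"
  shows "u (a \<sqinter> x) \<sqinter> b \<sqsubseteq> u (a' \<sqinter> x) \<sqinter> b'"
proof (rule X.meet_le)
  have ux: "u (a \<sqinter> x) \<sqinter> b \<sqsubseteq> u (a \<sqinter> x \<sqinter> d b)" using c by (intro parallel_u) auto
  have "a \<sqinter> x \<sqinter> d b = (a \<sqinter> d b) \<sqinter> x"
    using c X.meet_assoc[of a x "d b"] X.meet_assoc[of a "d b" x] X.meet_commute[of x "d b"] by simp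
  also have "\<dots> = (a' \<sqinter> d b') \<sqinter> x" using r by (simp add: rel_def)
  also have "\<dots> \<sqsubseteq> a' \<sqinter> x" using c by (intro X.meet_mono X.meet_left) auto
  finally have "u (a \<sqinter> x \<sqinter> d b) \<sqsubseteq> u (a' \<sqinter> x)" using c by (intro u_mono) auto
  then show "u (a \<sqinter> x) \<sqinter> b \<sqsubseteq> u (a' \<sqinter> x)" using ux c by (auto intro: X.le_trans)
  have "u (a \<sqinter> x) \<sqinter> b \<sqsubseteq> u a \<sqinter> b" using c by (intro X.meet_mono u_mono X.meet_left) auto
  also have "\<dots> = u a' \<sqinter> b'" using r by (simp add: rel_def)
  finally have "u (a \<sqinter> x) \<sqinter> b \<sqsubseteq> u a' \<sqinter> b'" .
  then show "u (a \<sqinter> x) \<sqinter> b \<sqsubseteq> b'" using c by (auto simp: X.le_meet_iff)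
qed (use c in auto)

text \<open>The mirror image of \<open>rel_meet_left_le\<close>: \<open>parallel_d\<close> moves
  \<open>a\<close> under \<open>d\<close> as a meet with \<open>u a\<close>.\<close>

lemma rel_meet_right_le:
  assumes c: "a \<in> carrier X" "b \<in> carrier X" "a' \<in> carrier X" "b' \<in> carrier X" "y \<in> carrier X"
    and r: "rel a b a' b'"
  shows "a \<sqinter> d (b \<sqinter> y) \<sqsubseteq> a' \<sqinter> d (b' \<sqinter> y)"
proof (rule X.meet_le)
  have dx: "a \<sqinter> d (b \<sqinter> y) \<sqsubseteq> d (u a \<sqinter> (b \<sqinter> y))" using c by (intro parallel_d) auto
  have "u a \<sqinter> (b \<sqinter> y) = (u a' \<sqinter> b') \<sqinter> y"
    using c r X.meet_assoc[of "u a" b y] by (simp add: rel_def)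
  also have "\<dots> \<sqsubseteq> b' \<sqinter> y" using c by (intro X.meet_mono X.meet_right) auto
  finally have "d (u a \<sqinter> (b \<sqinter> y)) \<sqsubseteq> d (b' \<sqinter> y)" using c by (intro d_mono) auto
  then show "a \<sqinter> d (b \<sqinter> y) \<sqsubseteq> d (b' \<sqinter> y)" using dx c by (auto intro: X.le_trans)
  have "a \<sqinter> d (b \<sqinter> y) \<sqsubseteq> a \<sqinter> d b" using c by (intro X.meet_mono d_mono X.meet_left) auto
  also have "\<dots> = a' \<sqinter> d b'" using r by (simp add: rel_def)
  finally have "a \<sqinter> d (b \<sqinter> y) \<sqsubseteq> a' \<sqinter> d b'" .
  then show "a \<sqinter> d (b \<sqinter> y) \<sqsubseteq> a'" using c by (auto simp: X.le_meet_iff)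
qed (use c in auto)

text \<open>Each one-sided inequality, applied in both directions by symmetry of \<open>rel\<close>,
  becomes an equation. In the condition on \<open>u\<close> only \<open>x\<close> stands under the
  function, so \<open>y\<close> is split off by associativity; in the condition on \<open>d\<close>
  the roles are exchanged.\<close>

lemma rel_meet:
  assumes c: "a \<in> carrier X" "b \<in> carrier X" "a' \<in> carrier X" "b' \<in> carrier X"
      "x \<in> carrier X" "y \<in> carrier X"
    and r: "rel a b a' b'"
  shows "rel (a \<sqinter> x) (b \<sqinter> y) (a' \<sqinter> x) (b' \<sqinter> y)"
proof -
  have "u (a \<sqinter> x) \<sqinter> b = u (a' \<sqinter> x) \<sqinter> b'"
    using c rel_meet_left_le[OF c(1-5) r] rel_meet_left_le[OF c(3,4,1,2,5) rel_sym[OF r]]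
    by (intro X.le_antisym) auto
  moreover have "a \<sqinter> d (b \<sqinter> y) = a' \<sqinter> d (b' \<sqinter> y)"
    using c rel_meet_right_le[OF c(1-4,6) r] rel_meet_right_le[OF c(3,4,1,2,6) rel_sym[OF r]]
    by (intro X.le_antisym) auto
  moreover have "a \<sqinter> x \<sqinter> d (b \<sqinter> y) = x \<sqinter> (a \<sqinter> d (b \<sqinter> y))"
    "a' \<sqinter> x \<sqinter> d (b' \<sqinter> y) = x \<sqinter> (a' \<sqinter> d (b' \<sqinter> y))"
    using c X.meet_assoc[of x a "d (b \<sqinter> y)"] X.meet_assoc[of x a' "d (b' \<sqinter> y)"]
      X.meet_commute[of x] by simp_all
  moreover have "u (a \<sqinter> x) \<sqinter> (b \<sqinter> y) = u (a \<sqinter> x) \<sqinter> b \<sqinter> y"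
    "u (a' \<sqinter> x) \<sqinter> (b' \<sqinter> y) = u (a' \<sqinter> x) \<sqinter> b' \<sqinter> y"
    using c by (simp_all add: X.meet_assoc)
  ultimately show ?thesis by (simp add: rel_def)
qed

text \<open>Trades the quantifier over all opens \<open>w\<close> for a closure condition on pairs.
  This is possible because \<open>rel\<close> is stable under meets and every open \<open>w\<close>
  is determined by the pairs in it.\<close>

lemma saturated_iff:
  "I \<in> saturated X u d \<longleftrightarrow> tensor_ideal X X I \<and>
    (\<forall>a\<in>carrier X. \<forall>b\<in>carrier X. \<forall>a'\<in>carrier X. \<forall>b'\<in>carrier X.
      rel a b a' b' \<longrightarrow> (a, b) \<in> I \<longrightarrow> (a', b') \<in> I)"
    (is "_ \<longleftrightarrow> _ \<and> ?closed")
proof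
  assume sat: "I \<in> saturated X u d"
  then have I: "tensor_ideal X X I" by (simp add: saturated_def)
  have "(a', b') \<in> I"
    if c: "a \<in> carrier X" "b \<in> carrier X" "a' \<in> carrier X" "b' \<in> carrier X"
      and r: "rel a b a' b'" and ab: "(a, b) \<in> I" for a b a' b'
  proof -
    have "rect_rel X u d (rect X X a b) (rect X X a' b')"
      using c r unfolding rect_rel_def rel_def by blast
    \<comment> \<open>The test open \<open>w\<close> is chosen as the top element, so meeting with
      it changes nothing.\<close>
    moreover have "carrier X \<times> carrier X \<in> carrier (tensor X X)" by (simp add: P.ideal_top)
    ultimately have "rect X X a b \<sqinter>\<^bsub>tensor X X\<^esub> (carrier X \<times> carrier X) \<subseteq> I \<longleftrightarrow>
        rect X X a' b' \<sqinter>\<^bsub>tensor X X\<^esub> (carrier X \<times> carrier X) \<subseteq> I"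
      using sat unfolding saturated_def by simp
    moreover have "P.gen s t \<inter> carrier X \<times> carrier X = P.gen s t" for s t
      by (auto simp: P.gen_def)
    ultimately have "P.gen a b \<subseteq> I \<longleftrightarrow> P.gen a' b' \<subseteq> I"
      using c by (simp add: P.rect_eq P.tensor_meet P.ideal_gen P.ideal_top)
    then show ?thesis using P.gen_least[OF I ab] P.gen_mem[OF c(3,4)] by blast
  qed
  with I show "tensor_ideal X X I \<and> ?closed" by blast
next
  assume "tensor_ideal X X I \<and> ?closed"
  then have I: "tensor_ideal X X I" and closed: ?closed by auto
  have half: "P.gen a' b' \<inter> w \<subseteq> I"
    if c: "a \<in> carrier X" "b \<in> carrier X" "a' \<in> carrier X" "b' \<in> carrier X"
      and r: "rel a b a' b'" and w: "tensor_ideal X X w" and sub: "P.gen a b \<inter> w \<subseteq> I"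
    for a b a' b' w
  proof clarify
    fix x y assume g: "(x, y) \<in> P.gen a' b'" and xyw: "(x, y) \<in> w"
    have xy: "x \<in> carrier X" "y \<in> carrier X" using tensor_idealD(1,2)[OF w xyw] .
    show "(x, y) \<in> I"
    \<comment> \<open>\<open>P.gen a' b'\<close> also contains all pairs with a bottom component.
      They need not lie below \<open>(a', b')\<close>, but they belong to every tensor
      ideal.\<close>
    proof (cases "x = \<bottom> \<or> y = \<bottom>")
      case True
      then show ?thesis using P.ideal_bottom_rows[OF I xy] by auto
    next
      case False
      then have le: "x \<sqsubseteq> a'" "y \<sqsubseteq> b'" using g by (auto simp: P.gen_def)
      \<comment> \<open>The meet of \<open>(a, b)\<close> with \<open>(x, y)\<close> lies in both
        \<open>P.gen a b\<close> and \<open>w\<close>. Since \<open>a' \<sqinter> x = x\<close> and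
        \<open>b' \<sqinter> y = y\<close>, \<open>rel_meet\<close> relates it to
        \<open>(x, y)\<close> itself.\<close>
      have "(a \<sqinter> x, b \<sqinter> y) \<in> w"
        by (rule tensor_idealD(3)[OF w xyw]) (use c xy X.meet_right in auto)
      moreover have "(a \<sqinter> x, b \<sqinter> y) \<in> P.gen a b"
        using c xy X.meet_left by (simp add: P.gen_def)
      ultimately have "(a \<sqinter> x, b \<sqinter> y) \<in> I" using sub by blast
      moreover have "rel (a \<sqinter> x) (b \<sqinter> y) x y"
        using rel_meet[OF c xy r] c xy le by (simp add: X.meet_eq_right)
      ultimately show ?thesis using closed c xy by (meson X.meet_closed)
    qed
  qed
  show "I \<in> saturated X u d"
    unfolding saturated_def
  proof (intro CollectI conjI allI impI ballI)
    show "I \<in> carrier (tensor X X)" using I by simp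
    fix p q w assume pq: "rect_rel X u d p q" and "w \<in> carrier (tensor X X)"
    then have w: "tensor_ideal X X w" by simp
    from pq obtain a b a' b' where
      c: "a \<in> carrier X" "b \<in> carrier X" "a' \<in> carrier X" "b' \<in> carrier X"
      and e: "p = rect X X a b" "q = rect X X a' b'" and r: "rel a b a' b'"
      unfolding rect_rel_def rel_def by blast
    show "p \<sqinter>\<^bsub>tensor X X\<^esub> w \<sqsubseteq>\<^bsub>tensor X X\<^esub> I \<longleftrightarrow> q \<sqinter>\<^bsub>tensor X X\<^esub> w \<sqsubseteq>\<^bsub>tensor X X\<^esub> I"
      using half[OF c r w] half[OF c(3,4,1,2) rel_sym[OF r] w] c
      by (auto simp: e P.rect_eq P.tensor_meet P.ideal_gen w)
  qed
qed

section \<open>Closure properties of saturated elements: intersections and Heyting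
  implications\<close>

lemma saturated_ideal: "I \<in> saturated X u d \<Longrightarrow> tensor_ideal X X I"
  by (simp add: saturated_iff)

lemma saturated_rel:
  "\<lbrakk>I \<in> saturated X u d; rel a b a' b'; a \<in> carrier X; b \<in> carrier X; a' \<in> carrier X;
    b' \<in> carrier X; (a, b) \<in> I\<rbrakk> \<Longrightarrow> (a', b') \<in> I"
  by (meson saturated_iff)

lemma saturatedI:
  assumes "tensor_ideal X X I"
    and "\<And>a b a' b'. \<lbrakk>a \<in> carrier X; b \<in> carrier X; a' \<in> carrier X; b' \<in> carrier X;
      rel a b a' b'; (a, b) \<in> I\<rbrakk> \<Longrightarrow> (a', b') \<in> I"
  shows "I \<in> saturated X u d"
  using assms by (simp add: saturated_iff)

lemma saturated_top: "carrier X \<times> carrier X \<in> saturated X u d"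
  by (rule saturatedI[OF P.ideal_top]) auto

lemma saturated_Inter:
  assumes "S \<subseteq> saturated X u d" "S \<noteq> {}"
  shows "\<Inter>S \<in> saturated X u d"
proof (rule saturatedI)
  show "tensor_ideal X X (\<Inter>S)" using assms by (intro P.ideal_Inter saturated_ideal) auto
  fix a b a' b'
  assume *: "a \<in> carrier X" "b \<in> carrier X" "a' \<in> carrier X" "b' \<in> carrier X"
    "rel a b a' b'" "(a, b) \<in> \<Inter>S"
  show "(a', b') \<in> \<Inter>S"
  proof
    fix I assume "I \<in> S"
    then show "(a', b') \<in> I" using assms(1) * saturated_rel[of I a b a' b'] by blast
  qed
qed

lemma saturated_Int:
  "\<lbrakk>I \<in> saturated X u d; J \<in> saturated X u d\<rbrakk> \<Longrightarrow> I \<inter> J \<in> saturated X u d"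
  using saturated_Inter[of "{I, J}"] by auto

text \<open>For an ideal \<open>I\<close>, the set is the Heyting implication from \<open>I\<close>
  to \<open>J\<close>. It inherits saturation from \<open>J\<close> alone, because related pairs
  remain related after a meet with any \<open>(a, b)\<close> in \<open>I\<close>.\<close>

lemma saturated_residual:
  assumes I: "I \<subseteq> carrier X \<times> carrier X" and J: "J \<in> saturated X u d"
  shows "{(x, y). x \<in> carrier X \<and> y \<in> carrier X \<and> (\<forall>(a, b)\<in>I. (a \<sqinter> x, b \<sqinter> y) \<in> J)}
    \<in> saturated X u d" (is "?K \<in> _")
proof (rule saturatedI)
  show "tensor_ideal X X ?K" by (rule P.ideal_residual[OF I saturated_ideal[OF J]])
  fix x y x' y'
  assume c: "x \<in> carrier X" "y \<in> carrier X" "x' \<in> carrier X" "y' \<in> carrier X"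
    and r: "rel x y x' y'" and K: "(x, y) \<in> ?K"
  have "(a \<sqinter> x', b \<sqinter> y') \<in> J" if ab: "(a, b) \<in> I" for a b
  proof (rule saturated_rel[OF J])
    have abc: "a \<in> carrier X" "b \<in> carrier X" using ab I by auto
    show "rel (a \<sqinter> x) (b \<sqinter> y) (a \<sqinter> x') (b \<sqinter> y')"
      using rel_meet[OF c abc r] X.meet_commute by simp
    show "(a \<sqinter> x, b \<sqinter> y) \<in> J" using K ab by auto
  qed (use c I ab in auto)
  then show "(x', y') \<in> ?K" using c by auto
qed

text \<open>The adjunction that characterises Heyting implication. From left to right a pair is
  tested against itself, using idempotence of meets; from right to left \<open>I\<close> and
  \<open>K\<close> are down-sets. It serves both distributivity in \<open>R\<close> and the
  preservation of meets by \<mu>.\<close>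

lemma residual_adjoint:
  assumes I: "tensor_ideal X X I" and J: "tensor_ideal X X J" and K: "tensor_ideal X X K"
  shows "K \<subseteq> {(x, y). x \<in> carrier X \<and> y \<in> carrier X \<and> (\<forall>(a, b)\<in>I. (a \<sqinter> x, b \<sqinter> y) \<in> J)}
    \<longleftrightarrow> I \<inter> K \<subseteq> J" (is "K \<subseteq> ?R \<longleftrightarrow> _")
proof
  assume sub: "K \<subseteq> ?R"
  show "I \<inter> K \<subseteq> J"
  proof clarify
    fix x y assume xy: "(x, y) \<in> I" "(x, y) \<in> K"
    then have "(x \<sqinter> x, y \<sqinter> y) \<in> J" using sub by auto
    then show "(x, y) \<in> J" using tensor_idealD(1,2)[OF I xy(1)] by (simp add: X.meet_eq_left)
  qed
next
  assume sub: "I \<inter> K \<subseteq> J"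
  show "K \<subseteq> ?R"
  proof clarify
    fix x y assume xy: "(x, y) \<in> K"
    note c = tensor_idealD(1,2)[OF K xy]
    have "(a \<sqinter> x, b \<sqinter> y) \<in> J" if ab: "(a, b) \<in> I" for a b
    proof -
      note c' = tensor_idealD(1,2)[OF I ab]
      have "(a \<sqinter> x, b \<sqinter> y) \<in> I"
        by (rule tensor_idealD(3)[OF I ab]) (use c c' X.meet_left in auto)
      moreover have "(a \<sqinter> x, b \<sqinter> y) \<in> K"
        by (rule tensor_idealD(3)[OF K xy]) (use c c' X.meet_right in auto)
      ultimately show ?thesis using sub by blast
    qed
    with c show "x \<in> carrier X \<and> y \<in> carrier X \<and> (\<forall>(a, b)\<in>I. (a \<sqinter> x, b \<sqinter> y) \<in> J)" by auto
  qed
qed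

section \<open>The induced localic relation\<close>

abbreviation R where "R \<equiv> induced_frame X u d"
abbreviation \<mu> where "\<mu> \<equiv> saturation X u d"

lemma induced_frame_simps [simp]:
  "carrier R = saturated X u d" "eq R = (=)" "(I \<sqsubseteq>\<^bsub>R\<^esub> J) = (I \<subseteq> J)"
  by (simp_all add: induced_frame_def tensor_def)

section \<open>The frame of saturated elements\<close>

lemma complete_lattice_induced: "complete_lattice R"
proof -
  interpret R: partial_order R by standard auto
  show ?thesis
  proof (rule R.complete_lattice_criterion1)
    show "\<exists>g. greatest R g (carrier R)"
      by (rule exI[of _ "carrier X \<times> carrier X"])
        (auto simp: greatest_def saturated_top dest: saturated_ideal tensor_idealD(1,2))
    fix S assume "S \<subseteq> carrier R" "S \<noteq> {}"
    then show "\<exists>i. greatest R i (Lower R S)"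
      by (intro exI[of _ "\<Inter>S"]) (auto simp: greatest_def Lower_def saturated_Inter subset_eq)
  qed
qed

sublocale R: complete_lattice R
  by (rule complete_lattice_induced)

lemma induced_meet:
  assumes "I \<in> saturated X u d" "J \<in> saturated X u d"
  shows "I \<sqinter>\<^bsub>R\<^esub> J = I \<inter> J"
  using assms saturated_Int[OF assms] R.meet_left[of I J] R.meet_right[of I J]
    R.meet_le[of "I \<inter> J" I J] by auto

lemma induced_top: "\<top>\<^bsub>R\<^esub> = carrier X \<times> carrier X"
  by (rule R.le_antisym)
    (use R.top_closed R.top_higher saturated_top in
      \<open>auto dest: saturated_ideal tensor_idealD(1,2)\<close>)

lemma induced_sup_closed: "S \<subseteq> saturated X u d \<Longrightarrow> \<Squnion>\<^bsub>R\<^esub>S \<in> saturated X u d"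
  using R.sup_closed[of S] by simp

lemma induced_sup_upper: "S \<subseteq> saturated X u d \<Longrightarrow> I \<in> S \<Longrightarrow> I \<subseteq> \<Squnion>\<^bsub>R\<^esub>S"
  using R.sup_upper[of S I] by simp

lemma induced_sup_least:
  "S \<subseteq> saturated X u d \<Longrightarrow> J \<in> saturated X u d \<Longrightarrow> (\<And>I. I \<in> S \<Longrightarrow> I \<subseteq> J) \<Longrightarrow> \<Squnion>\<^bsub>R\<^esub>S \<subseteq> J"
  using R.sup_least[of S J] by simp

text \<open>Joins in \<open>R\<close> are least upper bounds among saturated elements only, so
  distributivity is not read off from the tensor product. Instead, each \<open>J\<close> in
  \<open>S\<close> lies in the implication from \<open>I\<close> to the right-hand side; this
  implication is saturated and therefore contains the join of \<open>S\<close> in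
  \<open>R\<close>.\<close>

lemma frame_induced: "frame R"
proof (intro frame.intro complete_lattice_induced frame_axioms.intro)
  fix I S assume "I \<in> carrier R" "S \<subseteq> carrier R"
  then have I: "I \<in> saturated X u d" and S: "S \<subseteq> saturated X u d" by auto
  let ?S' = "(\<lambda>J. I \<sqinter>\<^bsub>R\<^esub> J) ` S"
  let ?K = "{(x, y). x \<in> carrier X \<and> y \<in> carrier X \<and>
    (\<forall>(a, b)\<in>I. (a \<sqinter> x, b \<sqinter> y) \<in> \<Squnion>\<^bsub>R\<^esub>?S')}"
  have S': "?S' \<subseteq> saturated X u d" using I S by (auto simp: induced_meet saturated_Int subset_eq)
  note sup = induced_sup_closed[OF S] and sup' = induced_sup_closed[OF S']
  have "I \<subseteq> carrier X \<times> carrier X" using tensor_idealD(1,2)[OF saturated_ideal[OF I]] by auto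
  then have K: "?K \<in> saturated X u d" using sup' by (rule saturated_residual)
  have "\<Squnion>\<^bsub>R\<^esub>S \<subseteq> ?K"
  proof (rule induced_sup_least[OF S K])
    fix J assume J: "J \<in> S"
    then have J': "J \<in> saturated X u d" using S by auto
    have "I \<inter> J \<subseteq> \<Squnion>\<^bsub>R\<^esub>?S'"
      using induced_sup_upper[OF S', of "I \<inter> J"] J induced_meet[OF I J'] by auto
    then show "J \<subseteq> ?K" using I J' sup' by (simp add: residual_adjoint saturated_ideal)
  qed
  then have "I \<inter> \<Squnion>\<^bsub>R\<^esub>S \<subseteq> \<Squnion>\<^bsub>R\<^esub>?S'" using I sup sup' by (simp add: residual_adjoint saturated_ideal)
  moreover have "\<Squnion>\<^bsub>R\<^esub>?S' \<subseteq> I \<inter> \<Squnion>\<^bsub>R\<^esub>S"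
  proof (rule induced_sup_least[OF S' saturated_Int[OF I sup]])
    fix K assume "K \<in> ?S'"
    then obtain J where J: "J \<in> S" "K = I \<inter> J" using S I by (auto simp: induced_meet subset_eq)
    then show "K \<subseteq> I \<inter> \<Squnion>\<^bsub>R\<^esub>S" using induced_sup_upper[OF S J(1)] by auto
  qed
  ultimately show "I \<sqinter>\<^bsub>R\<^esub> \<Squnion>\<^bsub>R\<^esub>S = \<Squnion>\<^bsub>R\<^esub>?S'"
    unfolding induced_meet[OF I sup] by (rule subset_antisym)
qed

section \<open>Saturation as a surjective frame map\<close>

lemma saturation_eq:
  assumes "tensor_ideal X X w"
  shows "\<mu> w = \<Inter>{I \<in> saturated X u d. w \<subseteq> I}" (is "_ = \<Inter>?S")
proof -
  have "w \<subseteq> carrier X \<times> carrier X" using tensor_idealD(1,2)[OF assms] by auto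
  \<comment> \<open>Nonemptiness matters: the intersection of the empty family would be the
    universal set, which need not be an ideal.\<close>
  then have "?S \<noteq> {}" using saturated_top by blast
  then have sat: "\<Inter>?S \<in> saturated X u d" by (intro saturated_Inter) auto
  have "least (tensor X X) (\<Inter>?S) ?S"
    using sat by (auto simp: least_def dest: saturated_ideal)
  moreover have "m = \<Inter>?S" if "least (tensor X X) m ?S" for m
    using that sat by (auto simp: least_def)
  ultimately show ?thesis unfolding saturation_def tensor_simps by (rule the_equality)
qed

lemma saturation_upper: "tensor_ideal X X w \<Longrightarrow> w \<subseteq> \<mu> w"
  by (auto simp: saturation_eq)

lemma saturation_closed:
  assumes "tensor_ideal X X w"
  shows "\<mu> w \<in> saturated X u d"
proof -
  have "w \<subseteq> carrier X \<times> carrier X" using tensor_idealD(1,2)[OF assms] by auto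
  then have "{I \<in> saturated X u d. w \<subseteq> I} \<noteq> {}" using saturated_top by blast
  then show ?thesis unfolding saturation_eq[OF assms] by (intro saturated_Inter) auto
qed

text \<open>\<mu> is left adjoint to the inclusion of the saturated elements. Inequalities with
  \<mu> on the left are handled through this rule.\<close>

lemma saturation_le_iff:
  assumes "tensor_ideal X X w" "I \<in> saturated X u d"
  shows "\<mu> w \<subseteq> I \<longleftrightarrow> w \<subseteq> I"
  using assms saturation_upper[OF assms(1)] by (auto simp: saturation_eq)

lemma saturation_saturated: "I \<in> saturated X u d \<Longrightarrow> \<mu> I = I"
  using saturation_le_iff[of I I] saturation_upper[of I] saturated_ideal by blast

text \<open>The nontrivial inclusion is the nucleus property of \<mu>; it follows from implications
  into saturated elements being saturated.\<close>

lemma saturation_Int: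
  assumes I: "tensor_ideal X X I" and J: "tensor_ideal X X J"
  shows "\<mu> (I \<inter> J) = \<mu> I \<inter> \<mu> J"
proof
  note IJ = P.ideal_Int[OF I J]
  note sI = saturation_closed[OF I] and sJ = saturation_closed[OF J]
    and sIJ = saturation_closed[OF IJ]
  show "\<mu> (I \<inter> J) \<subseteq> \<mu> I \<inter> \<mu> J"
    using saturation_upper[OF I] saturation_upper[OF J]
    by (simp add: saturation_le_iff[OF IJ] sI sJ) auto
  \<comment> \<open>By adjunction \<open>M\<close> lies in the implication from \<open>K\<close> to
    \<open>N\<close>. As that is saturated, it contains \<open>\<mu> M\<close>, and the adjunction
    leads back.\<close>
  have extend: "K \<inter> \<mu> M \<subseteq> N"
    if K: "tensor_ideal X X K" and M: "tensor_ideal X X M" and N: "N \<in> saturated X u d"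
      and sub: "K \<inter> M \<subseteq> N" for K M N
  proof -
    have "K \<subseteq> carrier X \<times> carrier X" using tensor_idealD(1,2)[OF K] by auto
    note res = saturated_residual[OF this N]
    show ?thesis
      using sub saturation_le_iff[OF M res]
      by (simp add: residual_adjoint K M saturated_ideal[OF N] saturated_ideal[OF saturation_closed[OF M]])
  qed
  have "I \<inter> \<mu> J \<subseteq> \<mu> (I \<inter> J)" by (rule extend[OF I J sIJ saturation_upper[OF IJ]])
  \<comment> \<open>Second use of \<open>extend\<close>, with the already saturated
    \<open>\<mu> J\<close> as \<open>K\<close> and \<open>I\<close> as \<open>M\<close>.\<close>
  then have "\<mu> J \<inter> \<mu> I \<subseteq> \<mu> (I \<inter> J)"
    by (intro extend[OF saturated_ideal[OF sJ] I sIJ]) auto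
  then show "\<mu> I \<inter> \<mu> J \<subseteq> \<mu> (I \<inter> J)" by auto
qed

lemma frame_map_saturation: "frame_map (tensor X X) R \<mu>"
  unfolding frame_map_def
proof (intro conjI)
  show "frame (tensor X X)" "frame R" by (rule P.frame_tensor frame_induced)+
  show "\<mu> \<in> carrier (tensor X X) \<rightarrow> carrier R" by (simp add: saturation_closed)
  show "\<mu> \<top>\<^bsub>tensor X X\<^esub> = \<top>\<^bsub>R\<^esub>"
    by (simp add: P.tensor_top induced_top saturation_saturated saturated_top)
  show "meet_pres (tensor X X) R \<mu>"
    unfolding meet_pres_def
    using P.T.lattice_axioms R.lattice_axioms
    by (simp add: P.tensor_meet induced_meet saturation_closed saturation_Int)
  show "sup_pres (tensor X X) R \<mu>"
    unfolding sup_pres_def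
  proof (intro conjI allI impI)
    show "complete_lattice (tensor X X)" "complete_lattice R"
      by (rule P.complete_lattice_tensor complete_lattice_induced)+
    fix S assume "S \<subseteq> carrier (tensor X X)"
    then have S: "S \<subseteq> {I. tensor_ideal X X I}" by simp
    then have im: "\<mu> ` S \<subseteq> saturated X u d" by (auto simp: saturation_closed)
    note sup = P.tensor_sup_closed[OF S] and sup' = induced_sup_closed[OF im]
    \<comment> \<open>The usual argument that a left adjoint preserves joins, with the two joins
      formed in different lattices.\<close>
    show "\<mu> (\<Squnion>\<^bsub>tensor X X\<^esub>S) = \<Squnion>\<^bsub>R\<^esub>(\<mu> ` S)"
    proof
      have "\<Squnion>\<^bsub>tensor X X\<^esub>S \<subseteq> \<Squnion>\<^bsub>R\<^esub>(\<mu> ` S)"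
      proof (rule P.tensor_sup_least[OF S saturated_ideal[OF sup']])
        fix I assume I: "I \<in> S"
        then show "I \<subseteq> \<Squnion>\<^bsub>R\<^esub>(\<mu> ` S)"
          using S induced_sup_upper[OF im imageI[OF I]] saturation_upper[of I] by blast
      qed
      then show "\<mu> (\<Squnion>\<^bsub>tensor X X\<^esub>S) \<subseteq> \<Squnion>\<^bsub>R\<^esub>(\<mu> ` S)" by (simp add: saturation_le_iff sup sup')
      show "\<Squnion>\<^bsub>R\<^esub>(\<mu> ` S) \<subseteq> \<mu> (\<Squnion>\<^bsub>tensor X X\<^esub>S)"
      proof (rule induced_sup_least[OF im saturation_closed[OF sup]])
        fix K assume "K \<in> \<mu> ` S"
        then obtain I where I: "I \<in> S" "K = \<mu> I" by blast
        then have "I \<subseteq> \<mu> (\<Squnion>\<^bsub>tensor X X\<^esub>S)"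
          using P.tensor_sup_upper[OF S] saturation_upper[OF sup] by blast
        then show "K \<subseteq> \<mu> (\<Squnion>\<^bsub>tensor X X\<^esub>S)"
          using I S saturation_le_iff[OF _ saturation_closed[OF sup], of I] by (simp add: subset_eq)
      qed
    qed
  qed
qed

lemma localic_relation_induced: "localic_relation X R \<mu>"
  unfolding localic_relation_def
proof
  show "\<mu> ` carrier (tensor X X) = carrier R"
  proof
    show "carrier R \<subseteq> \<mu> ` carrier (tensor X X)"
    proof
      fix I assume "I \<in> carrier R"
      then show "I \<in> \<mu> ` carrier (tensor X X)"
        using saturation_saturated[of I] saturated_ideal[of I]
        by (intro image_eqI[of _ _ I]) auto
    qed
  qed (auto simp: saturation_closed)
qed (rule frame_map_saturation)

section \<open>Source, target and cones\<close>

text \<open>Both sets are ideals because \<open>u\<close> and \<open>d\<close> are monotone,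
  preserve joins, and meets distribute over joins. They are saturated because membership depends
  only on \<open>u a \<sqinter> b\<close>, respectively \<open>a \<sqinter> d b\<close>, and
  \<open>rel\<close> fixes these two elements.\<close>

lemma saturated_below:
  assumes y: "y \<in> carrier X"
  shows "{(a, b). a \<in> carrier X \<and> b \<in> carrier X \<and> u a \<sqinter> b \<sqsubseteq> y} \<in> saturated X u d" (is "?U \<in> _")
    and "{(a, b). a \<in> carrier X \<and> b \<in> carrier X \<and> a \<sqinter> d b \<sqsubseteq> y} \<in> saturated X u d" (is "?D \<in> _")
proof -
  have im: "f ` A \<subseteq> carrier X" if "\<And>x. x \<in> carrier X \<Longrightarrow> f x \<in> carrier X" "A \<subseteq> carrier X" for f A
    using that by auto
  have sup_le: "\<Squnion>B \<sqinter> c \<sqsubseteq> y"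
    if "B \<subseteq> carrier X" "c \<in> carrier X" "\<And>b. b \<in> B \<Longrightarrow> b \<sqinter> c \<sqsubseteq> y" for B c
    unfolding X.sup_meet_distrib[OF that(2,1)] by (rule X.sup_least) (use that y in auto)
  have sup_u_eq: "u (\<Squnion>A) = \<Squnion>(u ` A)" and sup_d_eq: "d (\<Squnion>A) = \<Squnion>(d ` A)" if "A \<subseteq> carrier X" for A
    using sup_u sup_d that by (auto simp: sup_pres_def)
  show "?U \<in> saturated X u d"
  proof (rule saturatedI)
    show "tensor_ideal X X ?U"
    proof (rule tensor_idealI)
      fix a b s t assume *: "(a, b) \<in> ?U" "s \<in> carrier X" "t \<in> carrier X" "s \<sqsubseteq> a" "t \<sqsubseteq> b"
      then have "u s \<sqinter> t \<sqsubseteq> u a \<sqinter> b" by (intro X.meet_mono u_mono) auto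
      then show "(s, t) \<in> ?U" using * y by (auto intro: X.le_trans)
    next
      fix A b assume *: "A \<subseteq> carrier X" "b \<in> carrier X" "\<And>a. a \<in> A \<Longrightarrow> (a, b) \<in> ?U"
      then have "\<Squnion>(u ` A) \<sqinter> b \<sqsubseteq> y" by (intro sup_le im) auto
      then show "(\<Squnion>A, b) \<in> ?U" using * by (simp add: sup_u_eq)
    next
      fix a B assume *: "a \<in> carrier X" "B \<subseteq> carrier X" "\<And>b. b \<in> B \<Longrightarrow> (a, b) \<in> ?U"
      then have "\<Squnion>B \<sqinter> u a \<sqsubseteq> y" by (intro sup_le) (auto simp: X.meet_commute[of _ "u a"])
      then show "(a, \<Squnion>B) \<in> ?U" using * by (simp add: X.meet_commute[of _ "u a"])
    qed auto
  qed (auto simp: rel_def)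
  show "?D \<in> saturated X u d"
  proof (rule saturatedI)
    show "tensor_ideal X X ?D"
    proof (rule tensor_idealI)
      fix a b s t assume *: "(a, b) \<in> ?D" "s \<in> carrier X" "t \<in> carrier X" "s \<sqsubseteq> a" "t \<sqsubseteq> b"
      then have "s \<sqinter> d t \<sqsubseteq> a \<sqinter> d b" by (intro X.meet_mono d_mono) auto
      then show "(s, t) \<in> ?D" using * y by (auto intro: X.le_trans)
    next
      fix A b assume *: "A \<subseteq> carrier X" "b \<in> carrier X" "\<And>a. a \<in> A \<Longrightarrow> (a, b) \<in> ?D"
      then have "\<Squnion>A \<sqinter> d b \<sqsubseteq> y" by (intro sup_le) auto
      then show "(\<Squnion>A, b) \<in> ?D" using * by simp
    next
      fix a B assume *: "a \<in> carrier X" "B \<subseteq> carrier X" "\<And>b. b \<in> B \<Longrightarrow> (a, b) \<in> ?D"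
      then have "\<Squnion>(d ` B) \<sqinter> a \<sqsubseteq> y" by (intro sup_le im) (auto simp: X.meet_commute[of _ a])
      then show "(a, \<Squnion>B) \<in> ?D" using * by (simp add: sup_d_eq X.meet_commute[of _ a])
    qed auto
  qed (auto simp: rel_def)
qed

text \<open>\<open>inj2\<close> sends \<open>y\<close> to the ideal generated by
  \<open>(\<top>, y)\<close>, a pair that the saturated set on the right contains. Conversely every
  \<open>(a, b)\<close> in that set is related to \<open>(a, u a \<sqinter> b)\<close>, which lies
  below \<open>(\<top>, y)\<close>.\<close>

lemma target_eq:
  assumes y: "y \<in> carrier X"
  shows "target X \<mu> y = {(a, b). a \<in> carrier X \<and> b \<in> carrier X \<and> u a \<sqinter> b \<sqsubseteq> y}" (is "_ = ?K")
proof -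
  note gen = P.ideal_gen[OF X.top_closed y]
  have "P.gen \<top> y \<subseteq> ?K"
    using y by (intro P.gen_least saturated_ideal saturated_below) (auto intro: X.meet_right)
  then have "\<mu> (P.gen \<top> y) \<subseteq> ?K" by (simp add: saturation_le_iff[OF gen saturated_below(1)[OF y]])
  moreover have "?K \<subseteq> \<mu> (P.gen \<top> y)"
  proof clarify
    fix a b assume c: "a \<in> carrier X" "b \<in> carrier X" and le: "u a \<sqinter> b \<sqsubseteq> y"
    \<comment> \<open>The condition on \<open>u\<close> is idempotence of meets; the one on
      \<open>d\<close> is exactly \<open>parallel_d\<close>.\<close>
    have r: "rel a (u a \<sqinter> b) a b"
    proof -
      have "u a \<sqinter> (u a \<sqinter> b) = u a \<sqinter> b"
        using c by (intro X.meet_eq_right X.meet_left) auto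
      moreover have "a \<sqinter> d (u a \<sqinter> b) = a \<sqinter> d b"
      proof (rule X.le_antisym)
        show "a \<sqinter> d (u a \<sqinter> b) \<sqsubseteq> a \<sqinter> d b"
          using c by (intro X.meet_mono d_mono X.meet_right) auto
        show "a \<sqinter> d b \<sqsubseteq> a \<sqinter> d (u a \<sqinter> b)"
          using c by (intro X.meet_le X.meet_left parallel_d) auto
      qed (use c in auto)
      ultimately show ?thesis by (simp add: rel_def)
    qed
    have "(a, u a \<sqinter> b) \<in> P.gen \<top> y" using c le by (simp add: P.gen_def X.top_higher)
    then have "(a, u a \<sqinter> b) \<in> \<mu> (P.gen \<top> y)" using saturation_upper[OF gen] by blast
    then show "(a, b) \<in> \<mu> (P.gen \<top> y)"
      using c by (intro saturated_rel[OF saturation_closed[OF gen] r]) auto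
  qed
  ultimately show ?thesis by (simp add: target_def P.inj2_eq y)
qed

text \<open>As for \<open>target_eq\<close>, with the first side shrunk to
  \<open>a \<sqinter> d b\<close>; here \<open>parallel_u\<close> yields the relation.\<close>

lemma source_eq:
  assumes x: "x \<in> carrier X"
  shows "source X \<mu> x = {(a, b). a \<in> carrier X \<and> b \<in> carrier X \<and> a \<sqinter> d b \<sqsubseteq> x}" (is "_ = ?K")
proof -
  note gen = P.ideal_gen[OF x X.top_closed]
  have "P.gen x \<top> \<subseteq> ?K"
    using x by (intro P.gen_least saturated_ideal saturated_below) (auto intro: X.meet_left)
  then have "\<mu> (P.gen x \<top>) \<subseteq> ?K" by (simp add: saturation_le_iff[OF gen saturated_below(2)[OF x]])
  moreover have "?K \<subseteq> \<mu> (P.gen x \<top>)"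
  proof clarify
    fix a b assume c: "a \<in> carrier X" "b \<in> carrier X" and le: "a \<sqinter> d b \<sqsubseteq> x"
    have r: "rel (a \<sqinter> d b) b a b"
    proof -
      have "a \<sqinter> d b \<sqinter> d b = a \<sqinter> d b"
        using c by (intro X.meet_eq_left X.meet_right) auto
      moreover have "u (a \<sqinter> d b) \<sqinter> b = u a \<sqinter> b"
      proof (rule X.le_antisym)
        show "u (a \<sqinter> d b) \<sqinter> b \<sqsubseteq> u a \<sqinter> b"
          using c by (intro X.meet_mono u_mono X.meet_left) auto
        show "u a \<sqinter> b \<sqsubseteq> u (a \<sqinter> d b) \<sqinter> b"
          using c by (intro X.meet_le X.meet_right parallel_u) auto
      qed (use c in auto)
      ultimately show ?thesis by (simp add: rel_def)
    qed
    have "(a \<sqinter> d b, b) \<in> P.gen x \<top>" using c le by (simp add: P.gen_def X.top_higher)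
    then have "(a \<sqinter> d b, b) \<in> \<mu> (P.gen x \<top>)" using saturation_upper[OF gen] by blast
    then show "(a, b) \<in> \<mu> (P.gen x \<top>)"
      using c by (intro saturated_rel[OF saturation_closed[OF gen] r]) auto
  qed
  ultimately show ?thesis by (simp add: source_def P.inj1_eq x)
qed

text \<open>The common part of source (\<open>F a b = a \<sqinter> d b\<close>) and target (\<open>F a b = u a \<sqinter> b\<close>).\<close>

lemma
  assumes F: "\<And>a b. \<lbrakk>a \<in> carrier X; b \<in> carrier X\<rbrakk> \<Longrightarrow> F a b \<in> carrier X"
    and f: "frame_map X R f"
    and f_eq: "\<And>y. y \<in> carrier X \<Longrightarrow>
      f y = {(a, b). a \<in> carrier X \<and> b \<in> carrier X \<and> F a b \<sqsubseteq> y}"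
    and shrink: "\<And>a b y. \<lbrakk>a \<in> carrier X; b \<in> carrier X; y \<in> carrier X\<rbrakk> \<Longrightarrow>
      \<exists>a'\<in>carrier X. \<exists>b'\<in>carrier X. a' \<sqsubseteq> a \<and> b' \<sqsubseteq> b \<and> F a' b' = F a b \<sqinter> y"
  shows left_adjoint_join: "left_adjoint X R f (\<lambda>I. \<Squnion>((\<lambda>(a, b). F a b) ` I))"
    and open_map_join: "open_map X R f"
proof -
  let ?F = "\<lambda>(a, b). F a b"
  let ?g = "\<lambda>I. \<Squnion>(?F ` I)"
  have FI: "?F ` I \<subseteq> carrier X" if "I \<in> saturated X u d" for I
    using tensor_idealD(1,2)[OF saturated_ideal[OF that]] F by auto
  have fc: "f y \<in> saturated X u d" if "y \<in> carrier X" for y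
    using f that by (auto simp: frame_map_def)
  have gc: "?g I \<in> carrier X" if "I \<in> saturated X u d" for I using FI[OF that] by simp
  have F_le: "F a b \<sqsubseteq> ?g I" if "I \<in> saturated X u d" "(a, b) \<in> I" for I a b
    using X.sup_upper[OF FI[OF that(1)] imageI[OF that(2)]] by simp
  \<comment> \<open>A join lies below \<open>y\<close> iff all its members do, and
    \<open>f y\<close> consists of the pairs whose value under \<open>F\<close> lies below
    \<open>y\<close>.\<close>
  have adj: "?g I \<sqsubseteq> y \<longleftrightarrow> I \<subseteq> f y" if I: "I \<in> saturated X u d" and y: "y \<in> carrier X" for I y
  proof
    assume le: "?g I \<sqsubseteq> y"
    show "I \<subseteq> f y"
    proof clarify
      fix a b assume ab: "(a, b) \<in> I"
      note c = tensor_idealD(1,2)[OF saturated_ideal[OF I] ab]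
      show "(a, b) \<in> f y"
        using c X.le_trans[OF F_le[OF I ab] le F[OF c] gc[OF I] y] by (simp add: f_eq y)
    qed
  next
    assume "I \<subseteq> f y"
    then show "?g I \<sqsubseteq> y" by (intro X.sup_least FI I y) (auto simp: f_eq y)
  qed
  show la: "left_adjoint X R f ?g"
    unfolding left_adjoint_def galois_connection_def galois_connection_axioms_def connection_def
    using R.partial_order_axioms X.partial_order_axioms by (auto simp: gc fc adj)
  have frob: "?g (I \<inter> f y) = ?g I \<sqinter> y" if I: "I \<in> saturated X u d" and y: "y \<in> carrier X" for I y
  proof (rule X.le_antisym)
    note If = saturated_Int[OF I fc[OF y]]
    show "?g (I \<inter> f y) \<sqsubseteq> ?g I \<sqinter> y"
    proof (rule X.meet_le)
      show "?g (I \<inter> f y) \<sqsubseteq> y" by (simp add: adj If y)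
      show "?g (I \<inter> f y) \<sqsubseteq> ?g I" using adj[OF I gc[OF I]] gc[OF I] I by (auto simp: adj If)
    qed (use gc I y If in auto)
    have "?g I \<sqinter> y = \<Squnion>((\<lambda>z. z \<sqinter> y) ` ?F ` I)" by (rule X.sup_meet_distrib[OF y FI[OF I]])
    also have "\<dots> \<sqsubseteq> ?g (I \<inter> f y)"
    proof (rule X.sup_least)
      show "(\<lambda>z. z \<sqinter> y) ` ?F ` I \<subseteq> carrier X" using FI[OF I] y by auto
      fix z assume "z \<in> (\<lambda>z. z \<sqinter> y) ` ?F ` I"
      then obtain a b where ab: "(a, b) \<in> I" and z: "z = F a b \<sqinter> y" by auto
      note c = tensor_idealD(1,2)[OF saturated_ideal[OF I] ab]
      \<comment> \<open>By \<open>shrink\<close>, the element \<open>F a b \<sqinter> y\<close> is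
        itself a value of \<open>F\<close> at a smaller pair. That pair stays in the down-set
        \<open>I\<close> and lies in \<open>f y\<close>, so its value is one of those joined on the
        right.\<close>
      obtain a' b' where c': "a' \<in> carrier X" "b' \<in> carrier X" "a' \<sqsubseteq> a" "b' \<sqsubseteq> b"
        and e: "F a' b' = F a b \<sqinter> y" using shrink[OF c y] by blast
      have "(a', b') \<in> I" by (rule tensor_idealD(3)[OF saturated_ideal[OF I] ab c'])
      moreover have "(a', b') \<in> f y" using c' e F[OF c] y X.meet_right by (simp add: f_eq)
      ultimately show "z \<sqsubseteq> ?g (I \<inter> f y)" unfolding z e[symmetric] by (intro F_le If) auto
    qed (rule gc[OF If])
    finally show "?g I \<sqinter> y \<sqsubseteq> ?g (I \<inter> f y)" .
  qed (use gc I y fc saturated_Int in auto)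
  show "open_map X R f"
    unfolding open_map_def
    by (intro conjI f exI[of _ ?g] la ballI) (simp add: induced_meet fc frob)
qed

lemma source_shrink:
  assumes c: "a \<in> carrier X" "b \<in> carrier X" "x \<in> carrier X"
  shows "\<exists>a'\<in>carrier X. \<exists>b'\<in>carrier X. a' \<sqsubseteq> a \<and> b' \<sqsubseteq> b \<and> a' \<sqinter> d b' = a \<sqinter> d b \<sqinter> x"
proof (intro bexI conjI)
  \<comment> \<open>The witnesses are \<open>a \<sqinter> x\<close> and \<open>b\<close>: the side
    outside \<open>d\<close> absorbs the extra meet.\<close>
  show "a \<sqinter> x \<sqinter> d b = a \<sqinter> d b \<sqinter> x"
    using c X.meet_assoc[of a x "d b"] X.meet_assoc[of a "d b" x] X.meet_commute[of x "d b"] by simp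
qed (use c X.meet_left in auto)

lemma target_shrink:
  assumes c: "a \<in> carrier X" "b \<in> carrier X" "y \<in> carrier X"
  shows "\<exists>a'\<in>carrier X. \<exists>b'\<in>carrier X. a' \<sqsubseteq> a \<and> b' \<sqsubseteq> b \<and> u a' \<sqinter> b' = u a \<sqinter> b \<sqinter> y"
proof (intro bexI conjI)
  \<comment> \<open>The witnesses are \<open>a\<close> and \<open>b \<sqinter> y\<close>, since now
    the second side is outside \<open>u\<close>.\<close>
  show "u a \<sqinter> (b \<sqinter> y) = u a \<sqinter> b \<sqinter> y" using c by (simp add: X.meet_assoc)
qed (use c X.meet_left in auto)

section \<open>Openness of source and target, and the two cones\<close>

lemma frame_map_source: "frame_map X R (source X \<mu>)"
  unfolding source_def by (rule frame_map_compose[OF P.frame_map_inj1 frame_map_saturation])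

lemma frame_map_target: "frame_map X R (target X \<mu>)"
  unfolding target_def by (rule frame_map_compose[OF P.frame_map_inj2 frame_map_saturation])

lemma left_adjoint_source:
  "left_adjoint X R (source X \<mu>) (\<lambda>I. \<Squnion>((\<lambda>(a, b). a \<sqinter> d b) ` I))"
  by (rule left_adjoint_join[OF _ frame_map_source source_eq source_shrink]) auto

lemma left_adjoint_target:
  "left_adjoint X R (target X \<mu>) (\<lambda>I. \<Squnion>((\<lambda>(a, b). u a \<sqinter> b) ` I))"
  by (rule left_adjoint_join[OF _ frame_map_target target_eq target_shrink]) auto

lemma has_open_cones_induced: "has_open_cones X R \<mu>"
  unfolding has_open_cones_def
proof
  show "open_map X R (source X \<mu>)"
    by (rule open_map_join[OF _ frame_map_source source_eq source_shrink]) auto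
  show "open_map X R (target X \<mu>)"
    by (rule open_map_join[OF _ frame_map_target target_eq target_shrink]) auto
qed

text \<open>The cone at \<open>x\<close> is the join of all \<open>u a \<sqinter> b\<close> with
  \<open>a \<sqinter> d b \<sqsubseteq> x\<close>. Parallelism bounds each of them by
  \<open>u (a \<sqinter> d b)\<close>, hence by \<open>u x\<close>.\<close>

lemma up_cone_induced:
  assumes x: "x \<in> carrier X"
  shows "up_cone X R \<mu> x = u x"
proof -
  let ?K = "{(a, b). a \<in> carrier X \<and> b \<in> carrier X \<and> a \<sqinter> d b \<sqsubseteq> x}"
  let ?A = "(\<lambda>(a, b). u a \<sqinter> b) ` ?K"
  have A: "?A \<subseteq> carrier X" by auto
  have "up_cone X R \<mu> x = \<Squnion>?A"
    by (simp add: up_cone_def source_eq x direct_image_eq[OF left_adjoint_target] saturated_below)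
  also have "\<dots> = u x"
  proof (rule X.le_antisym)
    show "\<Squnion>?A \<sqsubseteq> u x"
    proof (rule X.sup_least[OF A])
      fix z assume "z \<in> ?A"
      then obtain a b where c: "a \<in> carrier X" "b \<in> carrier X" and le: "a \<sqinter> d b \<sqsubseteq> x"
        and z: "z = u a \<sqinter> b" by auto
      have "u (a \<sqinter> d b) \<sqsubseteq> u x" using c le x by (intro u_mono) auto
      then show "z \<sqsubseteq> u x" using parallel_u[OF c] c x by (auto simp: z intro: X.le_trans)
    qed (use x in auto)
    \<comment> \<open>The bound is attained at \<open>(x, \<top>)\<close>, whose contribution to the
      join is \<open>u x\<close>.\<close>
    have "(x, \<top>) \<in> ?K" using x X.meet_left by auto
    then have "u x \<sqinter> \<top> \<in> ?A" by (rule rev_image_eqI) simp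
    moreover have "u x \<sqinter> \<top> = u x" using x by (intro X.meet_eq_left X.top_higher) auto
    ultimately show "u x \<sqsubseteq> \<Squnion>?A" using X.sup_upper[OF A] by auto
  qed (use x A in auto)
  finally show ?thesis .
qed

lemma down_cone_induced:
  assumes y: "y \<in> carrier X"
  shows "down_cone X R \<mu> y = d y"
proof -
  let ?K = "{(a, b). a \<in> carrier X \<and> b \<in> carrier X \<and> u a \<sqinter> b \<sqsubseteq> y}"
  let ?A = "(\<lambda>(a, b). a \<sqinter> d b) ` ?K"
  have A: "?A \<subseteq> carrier X" by auto
  have "down_cone X R \<mu> y = \<Squnion>?A"
    by (simp add: down_cone_def target_eq y direct_image_eq[OF left_adjoint_source] saturated_below)
  also have "\<dots> = d y"
  proof (rule X.le_antisym)
    show "\<Squnion>?A \<sqsubseteq> d y"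
    proof (rule X.sup_least[OF A])
      fix z assume "z \<in> ?A"
      then obtain a b where c: "a \<in> carrier X" "b \<in> carrier X" and le: "u a \<sqinter> b \<sqsubseteq> y"
        and z: "z = a \<sqinter> d b" by auto
      have "d (u a \<sqinter> b) \<sqsubseteq> d y" using c le y by (intro d_mono) auto
      then show "z \<sqsubseteq> d y" using parallel_d[OF c] c y by (auto simp: z intro: X.le_trans)
    qed (use y in auto)
    \<comment> \<open>Dually to the up cone, the bound \<open>d y\<close> is attained at
      \<open>(\<top>, y)\<close>.\<close>
    have "(\<top>, y) \<in> ?K" using y X.meet_right by auto
    then have "\<top> \<sqinter> d y \<in> ?A" by (rule rev_image_eqI) simp
    moreover have "\<top> \<sqinter> d y = d y" using y by (intro X.meet_eq_right X.top_higher) auto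
    ultimately show "d y \<sqsubseteq> \<Squnion>?A" using X.sup_upper[OF A] by auto
  qed (use y A in auto)
  finally show ?thesis .
qed

end

theorem theorem7p7:
  fixes X :: "'a gorder" and u d :: "'a \<Rightarrow> 'a"
  assumes "frame X"
    and "parallel X u d"
    and "sup_pres X X u" and "sup_pres X X d"
  shows "localic_relation X (induced_frame X u d) (saturation X u d) \<and>
    has_open_cones X (induced_frame X u d) (saturation X u d) \<and>
    (\<forall>x\<in>carrier X. up_cone X (induced_frame X u d) (saturation X u d) x = u x) \<and>
    (\<forall>x\<in>carrier X. down_cone X (induced_frame X u d) (saturation X u d) x = d x)"
proof -
  interpret join_parallel_pair X u d
    using assms by (intro join_parallel_pair.intro join_parallel_pair_axioms.intro)
  show ?thesis
    using localic_relation_induced has_open_cones_induced up_cone_induced down_cone_induced by blast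
qed

end
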